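(* Let $T>0$, let $N\in\mathbb{N}$ with $N\ge 2$, and let $\tau=T/N$ (no other restriction on $\tau$). Let $\boldsymbol{u}_0,\boldsymbol{u}_1\in X_h$ be given, and let $(\boldsymbol{u}_{n+1},p_{n+1})\in X_h\times Y_h$, $n=1,\dots,N-1$, be generated by the generalized Laplacian IMEX scheme (all notation as in the context): for all $(\boldsymbol{w},q)\in X_h\times Y_h$, $$\Big\langle\tfrac{3}{2\tau}\boldsymbol{u}_{n+1}+\boldsymbol{u}^{\star}_{n+1}\cdot\nabla\boldsymbol{u}_{n+1},\boldsymbol{w}\Big\rangle+\big\langle\nu^{\star}_{n+1}\nabla\boldsymbol{u}_{n+1},\nabla\boldsymbol{w}\big\rangle-\langle p_{n+1},\nabla\cdot\boldsymbol{w}\rangle+\langle\nabla\cdot\boldsymbol{u}_{n+1},q\rangle$$ $$=\Big\langle\tfrac{4\boldsymbol{u}_n-\boldsymbol{u}_{n-1}}{2\tau}+2\nabla^{\top}\boldsymbol{u}_n\nabla\nu_n-\nabla^{\top}\boldsymbol{u}_{n-1}\nabla\nu_{n-1},\boldsymbol{w}\Big\rangle .$$ Then for any $\varepsilon\in(0,\tfrac1{10}]$, $$\|\boldsymbol{u}_N\|^2+\|\boldsymbol{u}^{\star}_{N+1}\|^2+8\varepsilon\tau\Big(5\big\|\sqrt{\nu^{\star}_N}\,\nabla\boldsymbol{u}_N\big\|^2+\big\|\sqrt{\nu^{\star}_{N-1}}\,\nabla\boldsymbol{u}_{N-1}\big\|^2\Big)+4(1-10\varepsilon)\tau\sum_{n=2}^{N}\big\|\sqrt{\nu^{\star}_n}\,\nabla\boldsymbol{u}_n\big\|^2\le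 C\exp\Big(\frac{\|\nabla\nu\|_\infty^2\,T}{\varepsilon\,\nu_{\min}}\Big),$$ where $$C=\|\boldsymbol{u}^{\star}_2\|^2+\|\boldsymbol{u}_1\|^2+40\tau\varepsilon\big\|\sqrt{\nu^{\star}_1}\,\nabla\boldsymbol{u}_1\big\|^2+8\varepsilon\tau\big\|\sqrt{\nu^{\star}_0}\,\nabla\boldsymbol{u}_0\big\|^2 .$$
   Context: $\Omega\subset\mathbb{R}^d$ ($d=2,3$) is a bounded domain with Lipschitz boundary, $Q=\Omega\times(0,T]$, and $t_n=n\tau$. $\langle\cdot,\cdot\rangle$ and $\|\cdot\|$ are the $L^2(\Omega)$ inner product and norm for scalars, vectors or tensors (Frobenius product for tensors), and $\|\cdot\|_\infty$ is the $L^\infty(\bar Q)$ norm. $X_h$ and $Y_h$ are the Taylor–Hood finite element spaces: continuous piecewise second-order velocities and continuous piecewise first-order pressures on a mesh of $\Omega$. The analysis is for zero body force and homogeneous Dirichlet conditions, i.e. all functions of $X_h$ vanish on $\partial\Omega$, so $X_h\subset H^1_0(\Omega)^d$. In particular $\boldsymbol{u}_n\in H^1_0(\Omega)^d$ for all $n$. Gradients: $(\nabla\boldsymbol{u})_{ij}=\partial_j u_i$, $(\nabla^{\top}\boldsymbol{u})_{ij}=\partial_i u_j$, so $(\nabla^{\top}\boldsymbol{u}\,\nabla\nu)_i=\sum_j \partial_i u_j\,\partial_j\nu$; and $(\boldsymbol{v}\cdot\nabla\boldsymbol{u})_i=\sum_j v_j\partial_j u_i$. Extrapolated velocity: $\boldsymbol{u}^{\star}_{n+1}=2\boldsymbol{u}_n-\boldsymbol{u}_{n-1}$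 for $n\ge1$. Viscosity: the field $\nu$ satisfies $0<\nu_{\min}\le\nu\le\nu_{\max}<\infty$. Either (i) $\nu(\boldsymbol{x},t)$ is prescribed, in which case $\nu_n=\nu(\cdot,t_n)$ and $\nu^{\star}_n=\nu(\cdot,t_n)$; or (ii) it is given by a rheological law $\nu=\eta(\dot\gamma(\boldsymbol{u}))$ with $\eta$ taking values in $[\nu_{\min},\nu_{\max}]$, $\dot\gamma(\boldsymbol{u})=\sqrt{2\nabla^{\mathrm s}\boldsymbol{u}:\nabla^{\mathrm s}\boldsymbol{u}}$ and $\nabla^{\mathrm s}\boldsymbol{u}=\frac12(\nabla\boldsymbol{u}+\nabla^{\top}\boldsymbol{u})$, in which case $\nu_n=\eta(\dot\gamma(\boldsymbol{u}_n))$ and $\nu^{\star}_{n+1}=\eta(\dot\gamma(\boldsymbol{u}^{\star}_{n+1}))$ for $n\ge1$. In case (ii), $\nu^{\star}_0,\nu^{\star}_1$ denote any measurable fields with values in $[\nu_{\min},\nu_{\max}]$. It is assumed that $\nu_n\in W^{1,\infty}(\Omega)$ for all $n$, and $\|\nabla\nu\|_\infty<\infty$ bounds $\|\nabla\nu_n\|_{L^\infty(\Omega)}$ for all $n$ (in case (ii) it is the supremum of these norms over the time levels). The convective term is assumed skew-symmetric: $\langle\boldsymbol{u}^{\star}_{n+1}\cdot\nabla\boldsymbol{u}_{n+1},\boldsymbol{u}_{n+1}\rangle=0$ for $n=1,\dots,N-1$ (as is the case when $\nabla\cdot\boldsymbol{u}^{\star}_{n+1}=0$ in $\Omega$ and $\boldsymbol{u}^{\star}_{n+1}\cdot\boldsymbol{n}=0$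 on $\partial\Omega$). *)

theory Defs
  imports "HOL-Analysis.Analysis" "HOL-Probability.Essential_Supremum"
begin

section \<open>Lebesgue spaces\<close>

text \<open>On matrices \<open>real^'d^'d\<close> the library inner product is the Frobenius product.\<close>

definition l2_inner :: "'a::euclidean_space set \<Rightarrow> ('a \<Rightarrow> 'b::real_inner) \<Rightarrow> ('a \<Rightarrow> 'b) \<Rightarrow> real" where
  "l2_inner \<Omega> f g = (LINT x|lebesgue_on \<Omega>. f x \<bullet> g x)"

definition l2_norm :: "'a::euclidean_space set \<Rightarrow> ('a \<Rightarrow> 'b::real_inner) \<Rightarrow> real" where
  "l2_norm \<Omega> f = sqrt (l2_inner \<Omega> f f)"

definition L2_space :: "'a::euclidean_space set \<Rightarrow> ('a \<Rightarrow> 'b::euclidean_space) set" where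
  "L2_space \<Omega> = {f. f \<in> borel_measurable (lebesgue_on \<Omega>) \<and>
                    integrable (lebesgue_on \<Omega>) (\<lambda>x. (norm (f x))\<^sup>2)}"

definition linf_norm :: "'a measure \<Rightarrow> ('a \<Rightarrow> 'b::euclidean_space) \<Rightarrow> ereal" where
  "linf_norm M f = (if f \<in> borel_measurable M then esssup M (\<lambda>x. ereal (norm (f x))) else \<infinity>)"

definition locally_integrable :: "'a::euclidean_space set \<Rightarrow> ('a \<Rightarrow> 'b::euclidean_space) \<Rightarrow> bool" where
  "locally_integrable \<Omega> f \<longleftrightarrow> f \<in> borel_measurable (lebesgue_on \<Omega>) \<and>
     (\<forall>K. compact K \<and> K \<subseteq> \<Omega> \<longrightarrow> f absolutely_integrable_on K)"


section \<open>Weak gradients and Sobolev spaces\<close>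

definition classical_grad :: "(real^'d \<Rightarrow> real) \<Rightarrow> real^'d \<Rightarrow> real^'d" where
  "classical_grad f x = (\<chi> i. frechet_derivative f (at x) (axis i 1))"

primrec C_k :: "nat \<Rightarrow> (real^'d \<Rightarrow> real) \<Rightarrow> bool" where
  "C_k 0 f \<longleftrightarrow> continuous_on UNIV f"
| "C_k (Suc k) f \<longleftrightarrow> f differentiable_on UNIV \<and> (\<forall>i. C_k k (\<lambda>x. classical_grad f x $ i))"

definition test_functions :: "(real^'d) set \<Rightarrow> (real^'d \<Rightarrow> real) set" where
  "test_functions \<Omega> = {\<phi>. (\<forall>k. C_k k \<phi>) \<and>
     compact (closure {x. \<phi> x \<noteq> 0}) \<and> closure {x. \<phi> x \<noteq> 0} \<subseteq> \<Omega>}"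

definition weak_gradient :: "(real^'d) set \<Rightarrow> (real^'d \<Rightarrow> real) \<Rightarrow> (real^'d \<Rightarrow> real^'d) \<Rightarrow> bool" where
  "weak_gradient \<Omega> f g \<longleftrightarrow> locally_integrable \<Omega> f \<and> locally_integrable \<Omega> g \<and>
     (\<forall>\<phi>\<in>test_functions \<Omega>.
        (LINT x|lebesgue_on \<Omega>. f x *\<^sub>R classical_grad \<phi> x) = - (LINT x|lebesgue_on \<Omega>. \<phi> x *\<^sub>R g x))"

text \<open>A representative of the weak gradient; it is determined by \<open>f\<close> up to a null subset of
  \<open>\<Omega>\<close>, and is meaningful only if \<open>f\<close> has a weak gradient at all.\<close>

definition wgrad :: "(real^'d) set \<Rightarrow> (real^'d \<Rightarrow> real) \<Rightarrow> real^'d \<Rightarrow> real^'d" where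
  "wgrad \<Omega> f = (SOME g. weak_gradient \<Omega> f g)"

text \<open>Row \<open>i\<close> is the gradient of the \<open>i\<close>-th component, i.e. the entry in row \<open>i\<close> and column \<open>j\<close>
  is the \<open>j\<close>-th partial derivative of component \<open>i\<close>.\<close>

definition vgrad :: "(real^'d) set \<Rightarrow> (real^'d \<Rightarrow> real^'d) \<Rightarrow> real^'d \<Rightarrow> real^'d^'d" where
  "vgrad \<Omega> u x = (\<chi> i. wgrad \<Omega> (\<lambda>y. u y $ i) x)"

definition vdiv :: "(real^'d) set \<Rightarrow> (real^'d \<Rightarrow> real^'d) \<Rightarrow> real^'d \<Rightarrow> real" where
  "vdiv \<Omega> u x = trace (vgrad \<Omega> u x)"

definition H1_space :: "(real^'d) set \<Rightarrow> (real^'d \<Rightarrow> real) set" where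
  "H1_space \<Omega> = {f. f \<in> L2_space \<Omega> \<and> (\<exists>g. weak_gradient \<Omega> f g) \<and> wgrad \<Omega> f \<in> L2_space \<Omega>}"

text \<open>The closure of the test functions in the \<open>H1\<close> norm.\<close>

definition H10_space :: "(real^'d) set \<Rightarrow> (real^'d \<Rightarrow> real) set" where
  "H10_space \<Omega> = {f \<in> H1_space \<Omega>. \<exists>\<phi>. (\<forall>k. \<phi> k \<in> test_functions \<Omega>) \<and>
     (\<lambda>k::nat. l2_norm \<Omega> (\<lambda>x. f x - \<phi> k x)) \<longlonglongrightarrow> 0 \<and>
     (\<lambda>k. l2_norm \<Omega> (\<lambda>x. wgrad \<Omega> f x - classical_grad (\<phi> k) x)) \<longlonglongrightarrow> 0}"

definition W1inf_space :: "(real^'d) set \<Rightarrow> (real^'d \<Rightarrow> real) set" where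
  "W1inf_space \<Omega> = {f. linf_norm (lebesgue_on \<Omega>) f < \<infinity> \<and> (\<exists>g. weak_gradient \<Omega> f g) \<and>
     linf_norm (lebesgue_on \<Omega>) (wgrad \<Omega> f) < \<infinity>}"


section \<open>Domain, mesh and Taylor--Hood spaces\<close>

text \<open>Near each boundary point, \<open>\<Omega>\<close> is the region above the graph, in some direction \<open>e\<close>, of a
  Lipschitz function \<open>g\<close> on the hyperplane orthogonal to \<open>e\<close>.\<close>

definition lipschitz_boundary :: "(real^'d) set \<Rightarrow> bool" where
  "lipschitz_boundary \<Omega> \<longleftrightarrow> (\<forall>x\<in>frontier \<Omega>. \<exists>r>0. \<exists>e. norm e = 1 \<and>
     (\<exists>L g. L-lipschitz_on {z. z \<bullet> e = 0} g \<and>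
        (\<forall>y\<in>ball x r. y \<in> \<Omega> \<longleftrightarrow> (g (y - (y \<bullet> e) *\<^sub>R e) :: real) < y \<bullet> e)))"

definition lipschitz_domain :: "(real^'d) set \<Rightarrow> bool" where
  "lipschitz_domain \<Omega> \<longleftrightarrow> open \<Omega> \<and> connected \<Omega> \<and> \<Omega> \<noteq> {} \<and> bounded \<Omega> \<and> lipschitz_boundary \<Omega>"

text \<open>A cell is the image of a reference simplex or cube under a map with polynomial components
  of order two (isoparametric elements). Affine maps give the classical P2/P1 elements on
  simplices; multilinear maps give the Q2/Q1 elements on quadrilaterals and hexahedra.\<close>

datatype cell_shape = Simplex_Cell | Cube_Cell

fun ref_cell :: "cell_shape \<Rightarrow> (real^'d) set" where
  "ref_cell Simplex_Cell = {x. (\<forall>i. 0 \<le> x $ i) \<and> (\<Sum>i\<in>UNIV. x $ i) \<le> 1}"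
| "ref_cell Cube_Cell = {x. \<forall>i. 0 \<le> x $ i \<and> x $ i \<le> 1}"

fun exponents :: "cell_shape \<Rightarrow> nat \<Rightarrow> ('d::finite \<Rightarrow> nat) set" where
  "exponents Simplex_Cell k = {\<alpha>. (\<Sum>i\<in>UNIV. \<alpha> i) \<le> k}"
| "exponents Cube_Cell k = {\<alpha>. \<forall>i. \<alpha> i \<le> k}"

text \<open>The polynomials of total degree at most \<open>k\<close> (simplex), or of degree at most \<open>k\<close> in each
  variable (cube).\<close>

definition shape_polys :: "cell_shape \<Rightarrow> nat \<Rightarrow> (real^'d \<Rightarrow> real) set" where
  "shape_polys s k = {p. \<exists>c. p = (\<lambda>x. \<Sum>\<alpha>\<in>exponents s k. c \<alpha> * (\<Prod>i\<in>UNIV. x $ i ^ \<alpha> i))}"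

text \<open>The last condition says that two distinct cells meet in a common proper face, possibly
  the empty one.\<close>

definition mesh_of :: "(cell_shape \<times> (real^'d \<Rightarrow> real^'d)) set \<Rightarrow> (real^'d) set \<Rightarrow> bool" where
  "mesh_of M \<Omega> \<longleftrightarrow> finite M \<and> (\<Union>(s, F)\<in>M. F ` ref_cell s) = closure \<Omega> \<and>
     (\<forall>(s, F)\<in>M. (\<forall>i. (\<lambda>x. F x $ i) \<in> shape_polys s 2) \<and> inj_on F (ref_cell s) \<and>
        (\<forall>x\<in>ref_cell s. det (jacobian F (at x)) \<noteq> 0)) \<and>
     (\<forall>(s, F)\<in>M. \<forall>(s', F')\<in>M. (s, F) \<noteq> (s', F') \<longrightarrow>
        (\<exists>A A'. A face_of ref_cell s \<and> A \<noteq> ref_cell s \<and> A' face_of ref_cell s' \<and> A' \<noteq> ref_cell s' \<and>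
           F ` ref_cell s \<inter> F' ` ref_cell s' = F ` A \<and> F ` A = F' ` A'))"

definition piecewise_poly :: "(cell_shape \<times> (real^'d \<Rightarrow> real^'d)) set \<Rightarrow> nat \<Rightarrow> (real^'d \<Rightarrow> real) \<Rightarrow> bool" where
  "piecewise_poly M k f \<longleftrightarrow> (\<forall>(s, F)\<in>M. \<exists>p\<in>shape_polys s k. \<forall>x\<in>ref_cell s. f (F x) = p x)"

text \<open>Continuous piecewise polynomials vanishing on the boundary lie in \<open>H10\<close> automatically; as is
  customary, the inclusion is built into the definition.\<close>

definition velocity_space ::
  "(cell_shape \<times> (real^'d \<Rightarrow> real^'d)) set \<Rightarrow> (real^'d) set \<Rightarrow> (real^'d \<Rightarrow> real^'d) set" where
  "velocity_space M \<Omega> = {v. continuous_on (closure \<Omega>) v \<and> (\<forall>x\<in>frontier \<Omega>. v x = 0) \<and>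
     (\<forall>i. piecewise_poly M 2 (\<lambda>x. v x $ i) \<and> (\<lambda>x. v x $ i) \<in> H10_space \<Omega>)}"

definition pressure_space ::
  "(cell_shape \<times> (real^'d \<Rightarrow> real^'d)) set \<Rightarrow> (real^'d) set \<Rightarrow> (real^'d \<Rightarrow> real) set" where
  "pressure_space M \<Omega> = {q. continuous_on (closure \<Omega>) q \<and> piecewise_poly M 1 q}"


section \<open>Extrapolation and viscosity\<close>

text \<open>\<open>ustar u m\<close> is the velocity extrapolated to time level \<open>m\<close>; only used for \<open>m \<ge> 2\<close>.\<close>

definition ustar :: "(nat \<Rightarrow> real^'d \<Rightarrow> real^'d) \<Rightarrow> nat \<Rightarrow> real^'d \<Rightarrow> real^'d" where
  "ustar u m = (\<lambda>x. 2 *\<^sub>R u (m - 1) x - u (m - 2) x)"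

definition sym_grad :: "(real^'d) set \<Rightarrow> (real^'d \<Rightarrow> real^'d) \<Rightarrow> real^'d \<Rightarrow> real^'d^'d" where
  "sym_grad \<Omega> u x = (1/2) *\<^sub>R (vgrad \<Omega> u x + transpose (vgrad \<Omega> u x))"

definition shear_rate :: "(real^'d) set \<Rightarrow> (real^'d \<Rightarrow> real^'d) \<Rightarrow> real^'d \<Rightarrow> real" where
  "shear_rate \<Omega> u x = sqrt (2 * (sym_grad \<Omega> u x \<bullet> sym_grad \<Omega> u x))"

definition viscosity_field :: "(real^'d) set \<Rightarrow> real \<Rightarrow> real \<Rightarrow> (real^'d \<Rightarrow> real) \<Rightarrow> bool" where
  "viscosity_field \<Omega> \<nu>min \<nu>max f \<longleftrightarrow> f \<in> borel_measurable (lebesgue_on \<Omega>) \<and>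
     (AE x in lebesgue_on \<Omega>. \<nu>min \<le> f x \<and> f x \<le> \<nu>max)"

text \<open>In the next two definitions \<open>\<nu> n\<close> and \<open>\<nu>s n\<close> are the viscosity and the extrapolated
  viscosity at time level \<open>n\<close>, and \<open>G\<close> is the maximum norm of the viscosity gradient: the norm over
  the space-time cylinder of the spatial gradient \<open>D\<close> if the viscosity \<open>V\<close> is prescribed, and the
  supremum over the time levels for a rheological law \<open>\<eta>\<close>.\<close>

definition prescribed_viscosity ::
  "(real^'d) set \<Rightarrow> real \<Rightarrow> nat \<Rightarrow> real \<Rightarrow> real \<Rightarrow> (real^'d \<Rightarrow> real \<Rightarrow> real) \<Rightarrow>
   (nat \<Rightarrow> real^'d \<Rightarrow> real) \<Rightarrow> (nat \<Rightarrow> real^'d \<Rightarrow> real) \<Rightarrow> real \<Rightarrow> bool" where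
  "prescribed_viscosity \<Omega> T N \<nu>min \<nu>max V \<nu> \<nu>s G \<longleftrightarrow>
     (\<forall>t\<in>{0..T}. viscosity_field \<Omega> \<nu>min \<nu>max (\<lambda>x. V x t)) \<and>
     (\<forall>n\<le>N. \<nu> n = (\<lambda>x. V x (real n * (T / real N))) \<and> \<nu>s n = (\<lambda>x. V x (real n * (T / real N)))) \<and>
     (\<exists>D. (AE t in lebesgue_on {0..T}. weak_gradient \<Omega> (\<lambda>x. V x t) (\<lambda>x. D x t)) \<and>
          ereal G = linf_norm (lebesgue_on (\<Omega> \<times> {0..T})) (\<lambda>(x, t). D x t)) \<and>
     (\<forall>n\<le>N. linf_norm (lebesgue_on \<Omega>) (wgrad \<Omega> (\<nu> n)) \<le> ereal G)"

definition rheological_viscosity ::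
  "(real^'d) set \<Rightarrow> nat \<Rightarrow> real \<Rightarrow> real \<Rightarrow> (real \<Rightarrow> real) \<Rightarrow> (nat \<Rightarrow> real^'d \<Rightarrow> real^'d) \<Rightarrow>
   (nat \<Rightarrow> real^'d \<Rightarrow> real) \<Rightarrow> (nat \<Rightarrow> real^'d \<Rightarrow> real) \<Rightarrow> real \<Rightarrow> bool" where
  "rheological_viscosity \<Omega> N \<nu>min \<nu>max \<eta> u \<nu> \<nu>s G \<longleftrightarrow>
     \<eta> \<in> borel_measurable (restrict_space borel {0..}) \<and>
     (\<forall>s\<ge>0. \<nu>min \<le> \<eta> s \<and> \<eta> s \<le> \<nu>max) \<and>
     (\<forall>n\<le>N. \<nu> n = (\<lambda>x. \<eta> (shear_rate \<Omega> (u n) x))) \<and>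
     (\<forall>m\<in>{2..N}. \<nu>s m = (\<lambda>x. \<eta> (shear_rate \<Omega> (ustar u m) x))) \<and>
     viscosity_field \<Omega> \<nu>min \<nu>max (\<nu>s 0) \<and> viscosity_field \<Omega> \<nu>min \<nu>max (\<nu>s 1) \<and>
     ereal G = (SUP n\<in>{..N}. linf_norm (lebesgue_on \<Omega>) (wgrad \<Omega> (\<nu> n)))"


section \<open>The IMEX scheme\<close>

text \<open>One step, from time levels \<open>n - 1\<close> and \<open>n\<close> to \<open>n + 1\<close>, for \<open>n \<ge> 1\<close>.\<close>

definition imex_step ::
  "(real^'d) set \<Rightarrow> (real^'d \<Rightarrow> real^'d) set \<Rightarrow> (real^'d \<Rightarrow> real) set \<Rightarrow> real \<Rightarrow>
   (nat \<Rightarrow> real^'d \<Rightarrow> real) \<Rightarrow> (nat \<Rightarrow> real^'d \<Rightarrow> real) \<Rightarrow>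
   (nat \<Rightarrow> real^'d \<Rightarrow> real^'d) \<Rightarrow> (nat \<Rightarrow> real^'d \<Rightarrow> real) \<Rightarrow> nat \<Rightarrow> bool" where
  "imex_step \<Omega> Xh Yh \<tau> \<nu> \<nu>s u p n \<longleftrightarrow> (\<forall>w\<in>Xh. \<forall>q\<in>Yh.
     l2_inner \<Omega> (\<lambda>x. (3 / (2 * \<tau>)) *\<^sub>R u (n + 1) x + vgrad \<Omega> (u (n + 1)) x *v ustar u (n + 1) x) w
     + l2_inner \<Omega> (\<lambda>x. \<nu>s (n + 1) x *\<^sub>R vgrad \<Omega> (u (n + 1)) x) (vgrad \<Omega> w)
     - l2_inner \<Omega> (p (n + 1)) (vdiv \<Omega> w)
     + l2_inner \<Omega> (vdiv \<Omega> (u (n + 1))) q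
     = l2_inner \<Omega> (\<lambda>x. (1 / (2 * \<tau>)) *\<^sub>R (4 *\<^sub>R u n x - u (n - 1) x)
          + 2 *\<^sub>R (transpose (vgrad \<Omega> (u n) x) *v wgrad \<Omega> (\<nu> n) x)
          - transpose (vgrad \<Omega> (u (n - 1)) x) *v wgrad \<Omega> (\<nu> (n - 1)) x) w)"

end

theory Submission
  imports Defs
begin

text \<open>Testing the scheme with \<open>u (n + 1)\<close> and \<open>p (n + 1)\<close> removes the convective and pressure terms,
  and the BDF2 identity turns the rest into an energy balance with forcing
  \<open>4 * \<tau> * \<langle>2 * \<nabla>u\<^sub>n\<^sup>T \<nabla>\<nu>\<^sub>n - \<nabla>u\<^sub>n\<^sub>-\<^sub>1\<^sup>T \<nabla>\<nu>\<^sub>n\<^sub>-\<^sub>1, u\<^sub>n\<^sub>+\<^sub>1\<rangle>\<close>. By Young's inequality the forcing is at most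
  \<open>a * \<parallel>u\<^sub>n\<^sub>+\<^sub>1\<parallel>\<^sup>2 + b * R\<close> whenever \<open>a * b = s\<close>, where \<open>s = \<tau> * G\<^sup>2 / (\<epsilon> * \<nu>min)\<close> and \<open>R\<close> is the part of the
  old energy that the viscous terms release.

  The implicit term \<open>s * \<parallel>u\<^sub>n\<^sub>+\<^sub>1\<parallel>\<^sup>2\<close> would force \<open>s < 1\<close> in the usual discrete Gronwall argument. The
  restriction on \<open>\<tau>\<close> is avoided because the BDF2 form, including its dissipation
  \<open>\<parallel>u\<^sub>n\<^sub>+\<^sub>1 - u\<^sup>\<star>\<^sub>n\<^sub>+\<^sub>1\<parallel>\<^sup>2\<close>, controls \<open>3 * \<parallel>u\<^sub>n\<^sub>+\<^sub>1\<parallel>\<^sup>2\<close> up to \<open>2/3\<close> of the old energy. Hence one step multiplies the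
  energy by at most \<open>1 + 5/3 * s / (3 - s) \<le> exp s\<close> if \<open>s \<le> 12/5\<close>; for larger \<open>s\<close> the choice
  \<open>a = 1/2\<close> gives the factor \<open>4 * s \<le> exp s\<close>.\<close>

section \<open>Square-integrable fields\<close>

lemma borel_measurable_vec_nth_iff:
  fixes f :: "'a \<Rightarrow> 'b::euclidean_space^'n"
  shows "f \<in> borel_measurable M \<longleftrightarrow> (\<forall>i. (\<lambda>x. f x $ i) \<in> borel_measurable M)"
proof
  assume "f \<in> borel_measurable M"
  then show "\<forall>i. (\<lambda>x. f x $ i) \<in> borel_measurable M"
    by (intro allI borel_measurable_continuous_on[where f = "\<lambda>y. y $ _"] continuous_on_component continuous_on_id)
next
  assume *: "\<forall>i. (\<lambda>x. f x $ i) \<in> borel_measurable M"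
  show "f \<in> borel_measurable M"
    unfolding borel_measurable_euclidean_space[of f]
    by (use * in \<open>auto simp: Basis_vec_def inner_axis intro!: borel_measurable_inner\<close>)
qed

lemma borel_measurable_matrix_vector_mult:
  fixes A :: "'a \<Rightarrow> real^'n^'m" and v :: "'a \<Rightarrow> real^'n"
  assumes "A \<in> borel_measurable M" "v \<in> borel_measurable M"
  shows "(\<lambda>x. A x *v v x) \<in> borel_measurable M"
  using assms unfolding borel_measurable_vec_nth_iff matrix_vector_mult_def
  by (auto intro!: borel_measurable_sum borel_measurable_times)

lemma borel_measurable_transpose:
  fixes A :: "'a \<Rightarrow> real^'n^'m"
  assumes "A \<in> borel_measurable M"
  shows "(\<lambda>x. transpose (A x)) \<in> borel_measurable M"
  using assms by (simp add: borel_measurable_vec_nth_iff transpose_def)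

lemma norm_vec_power2:
  fixes x :: "'b::real_inner^'n"
  shows "(norm x)\<^sup>2 = (\<Sum>i\<in>UNIV. (norm (x $ i))\<^sup>2)"
  by (simp add: power2_norm_eq_inner inner_vec_def)

text \<open>Cauchy-Schwarz in each row; the norm on matrices is the Frobenius norm, so the squared
  row norms add up to it.\<close>

lemma norm_matrix_vector_mult_le:
  fixes A :: "real^'n^'m" and x :: "real^'n"
  shows "norm (A *v x) \<le> norm A * norm x"
proof (rule power2_le_imp_le)
  have "(norm (A *v x))\<^sup>2 = (\<Sum>i\<in>UNIV. (A $ i \<bullet> x)\<^sup>2)"
    by (simp add: norm_vec_power2 matrix_vector_mul_component)
  also have "\<dots> \<le> (\<Sum>i\<in>UNIV. (norm (A $ i))\<^sup>2 * (norm x)\<^sup>2)"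
    by (intro sum_mono) (metis Cauchy_Schwarz_ineq power2_norm_eq_inner)
  also have "\<dots> = (norm A * norm x)\<^sup>2"
    by (simp add: norm_vec_power2[of A] power_mult_distrib sum_distrib_right)
  finally show "(norm (A *v x))\<^sup>2 \<le> (norm A * norm x)\<^sup>2" .
qed simp

lemma norm_transpose:
  fixes A :: "real^'n^'m"
  shows "norm (transpose A) = norm A"
proof (rule power2_eq_imp_eq)
  show "(norm (transpose A))\<^sup>2 = (norm A)\<^sup>2"
    by (simp add: norm_vec_power2 transpose_def) (rule sum.swap)
qed simp_all

lemma L2_spaceI:
  assumes "g \<in> L2_space \<Omega>" "f \<in> borel_measurable (lebesgue_on \<Omega>)"
    and "AE x in lebesgue_on \<Omega>. norm (f x) \<le> K * norm (g x)"
  shows "f \<in> L2_space \<Omega>"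
proof -
  have "integrable (lebesgue_on \<Omega>) (\<lambda>x. K\<^sup>2 * (norm (g x))\<^sup>2)"
    using assms(1) by (simp add: L2_space_def)
  moreover have "AE x in lebesgue_on \<Omega>. norm ((norm (f x))\<^sup>2) \<le> norm (K\<^sup>2 * (norm (g x))\<^sup>2)"
    using assms(3)
  proof eventually_elim
    case (elim x)
    then show ?case
      using power_mono[OF elim norm_ge_zero, of 2] by (simp add: power_mult_distrib)
  qed
  ultimately have "integrable (lebesgue_on \<Omega>) (\<lambda>x. (norm (f x))\<^sup>2)"
    using assms(2) by (elim Bochner_Integration.integrable_bound) auto
  then show ?thesis
    using assms(2) by (simp add: L2_space_def)
qed

text \<open>Rests on (a + b)^2 \<le> 2 a^2 + 2 b^2 and yields closure under differences.\<close>

lemma L2_space_norm_le: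
  assumes "f \<in> L2_space \<Omega>" "g \<in> L2_space \<Omega>" "h \<in> borel_measurable (lebesgue_on \<Omega>)"
    and "AE x in lebesgue_on \<Omega>. norm (h x) \<le> norm (f x) + norm (g x)"
  shows "h \<in> L2_space \<Omega>"
proof -
  have "integrable (lebesgue_on \<Omega>) (\<lambda>x. 2 * (norm (f x))\<^sup>2 + 2 * (norm (g x))\<^sup>2)"
    using assms(1,2) by (simp add: L2_space_def)
  moreover have "AE x in lebesgue_on \<Omega>. norm ((norm (h x))\<^sup>2) \<le> norm (2 * (norm (f x))\<^sup>2 + 2 * (norm (g x))\<^sup>2)"
    using assms(4)
  proof eventually_elim
    case (elim x)
    then have "(norm (h x))\<^sup>2 \<le> (norm (f x) + norm (g x))\<^sup>2"
      by (simp add: power_mono)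
    also have "\<dots> \<le> 2 * (norm (f x))\<^sup>2 + 2 * (norm (g x))\<^sup>2"
      using zero_le_power2[of "norm (f x) - norm (g x)"] by (simp add: power2_eq_square algebra_simps)
    finally show ?case by simp
  qed
  ultimately have "integrable (lebesgue_on \<Omega>) (\<lambda>x. (norm (h x))\<^sup>2)"
    using assms(3) by (elim Bochner_Integration.integrable_bound) auto
  then show ?thesis
    using assms(3) by (simp add: L2_space_def)
qed

section \<open>Algebra of square-integrable fields\<close>

lemma L2_space_scaleR: "f \<in> L2_space \<Omega> \<Longrightarrow> (\<lambda>x. c *\<^sub>R f x) \<in> L2_space \<Omega>"
  by (rule L2_spaceI[where K = "\<bar>c\<bar>"]) (auto simp: L2_space_def)

lemma L2_space_diff: "f \<in> L2_space \<Omega> \<Longrightarrow> g \<in> L2_space \<Omega> \<Longrightarrow> (\<lambda>x. f x - g x) \<in> L2_space \<Omega>"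
  by (rule L2_space_norm_le[of f _ g]) (auto simp: L2_space_def norm_triangle_ineq4)

lemma L2_space_vec:
  fixes f :: "'a::euclidean_space \<Rightarrow> 'b::euclidean_space^'n"
  assumes "\<And>i. (\<lambda>x. f x $ i) \<in> L2_space \<Omega>"
  shows "f \<in> L2_space \<Omega>"
  using assms by (simp add: L2_space_def borel_measurable_vec_nth_iff norm_vec_power2)

text \<open>Linearity of \<open>l2_inner\<close> rests on this: a non-integrable function has
  integral 0 by convention, so sums may be split only after integrability is known.\<close>

lemma L2_space_integrable_inner:
  assumes "f \<in> L2_space \<Omega>" "g \<in> L2_space \<Omega>"
  shows "integrable (lebesgue_on \<Omega>) (\<lambda>x. f x \<bullet> g x)"
proof (rule Bochner_Integration.integrable_bound)
  show "integrable (lebesgue_on \<Omega>) (\<lambda>x. (norm (f x))\<^sup>2 + (norm (g x))\<^sup>2)"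
    using assms by (simp add: L2_space_def)
  show "(\<lambda>x. f x \<bullet> g x) \<in> borel_measurable (lebesgue_on \<Omega>)"
    using assms by (auto simp: L2_space_def intro!: borel_measurable_inner)
  have "\<bar>f x \<bullet> g x\<bar> \<le> (norm (f x))\<^sup>2 + (norm (g x))\<^sup>2" for x
  proof -
    have "\<bar>f x \<bullet> g x\<bar> \<le> norm (f x) * norm (g x)"
      by (rule Cauchy_Schwarz_ineq2)
    also have "\<dots> \<le> (norm (f x))\<^sup>2 + (norm (g x))\<^sup>2"
    proof -
      have "0 \<le> norm (f x) * norm (g x)" by simp
      then show ?thesis
        using sum_squares_bound[of "norm (f x)" "norm (g x)"] by linarith
    qed
    finally show ?thesis .
  qed
  then show "AE x in lebesgue_on \<Omega>. norm (f x \<bullet> g x) \<le> norm ((norm (f x))\<^sup>2 + (norm (g x))\<^sup>2)"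
    by simp
qed

lemma l2_norm_power2: "(l2_norm \<Omega> f)\<^sup>2 = (LINT x|lebesgue_on \<Omega>. (norm (f x))\<^sup>2)"
  by (simp add: l2_norm_def l2_inner_def power2_norm_eq_inner)

text \<open>Measurability comes for free, since \<open>linf_norm\<close> is infinite on
  non-measurable functions and the bound is finite.\<close>

lemma AE_le_of_linf_norm:
  assumes "linf_norm M f \<le> ereal G"
  shows "f \<in> borel_measurable M" "AE x in M. norm (f x) \<le> G"
proof -
  show "f \<in> borel_measurable M"
    using assms by (auto simp: linf_norm_def split: if_splits)
  then have le: "esssup M (\<lambda>x. ereal (norm (f x))) \<le> ereal G"
    using assms by (simp add: linf_norm_def)
  from esssup_AE[of "\<lambda>x. ereal (norm (f x))" M] show "AE x in M. norm (f x) \<le> G"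
  proof eventually_elim
    case (elim x)
    then show ?case
      using order_trans[OF _ le] by fastforce
  qed
qed

section \<open>Weak gradients and viscosity fields\<close>

text \<open>On the compact set \<open>K\<close> the continuous factor is bounded and
  \<open>f\<close> is integrable; off \<open>K\<close> the product vanishes, so integrating over
  \<open>K\<close> or over \<open>\<Omega>\<close> is the same. It makes the integrals against test
  functions and their gradients exist.\<close>

lemma locally_integrable_product:
  fixes H :: "'c::euclidean_space \<Rightarrow> 'b::euclidean_space \<Rightarrow> 'e::euclidean_space"
    and f :: "'a::euclidean_space \<Rightarrow> 'b"
  assumes f: "locally_integrable \<Omega> f" and \<Omega>: "open \<Omega>" and H: "bilinear H"
    and h: "continuous_on UNIV h" and K: "compact K" "K \<subseteq> \<Omega>" "\<And>x. x \<notin> K \<Longrightarrow> h x = 0"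
  shows "integrable (lebesgue_on \<Omega>) (\<lambda>x. H (h x) (f x))"
proof -
  have K_sets: "K \<in> sets lebesgue"
    using K(1) by (simp add: lmeasurable_compact fmeasurableD)
  have "(\<lambda>x. H (h x) (f x)) absolutely_integrable_on K"
  proof (rule absolutely_integrable_bounded_measurable_product[OF H _ K_sets])
    show "h \<in> borel_measurable (lebesgue_on K)"
      using h K_sets by (meson continuous_imp_measurable_on_sets_lebesgue continuous_on_subset subset_UNIV)
    show "bounded (h ` K)"
      using h K(1) by (meson compact_continuous_image compact_imp_bounded continuous_on_subset subset_UNIV)
    show "f absolutely_integrable_on K"
      using f K by (simp add: locally_integrable_def)
  qed
  moreover have "indicator K x *\<^sub>R H (h x) (f x) = indicator \<Omega> x *\<^sub>R H (h x) (f x)" for x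
    by (cases "x \<in> K") (use K(2) K(3)[of x] bilinear_lzero[OF H] in \<open>auto simp: indicator_def\<close>)
  ultimately show ?thesis
    using \<Omega> by (simp add: integrable_restrict_space set_integrable_def)
qed

lemma continuous_on_classical_grad:
  assumes "\<phi> \<in> test_functions \<Omega>"
  shows "continuous_on UNIV (classical_grad \<phi>)"
proof -
  have "C_k (Suc 0) \<phi>"
    using assms by (simp add: test_functions_def del: C_k.simps)
  then have "continuous_on UNIV (\<lambda>x. \<chi> i. classical_grad \<phi> x $ i)"
    by (intro continuous_on_vec_lambda) simp
  then show ?thesis by simp
qed

text \<open>The complement of the support is open and \<open>\<phi>\<close> is zero on it, so the
  derivative there is that of a constant.\<close>

lemma classical_grad_eq_0:
  assumes "x \<notin> closure {x. \<phi> x \<noteq> 0}"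
  shows "classical_grad \<phi> x = 0"
proof -
  have "(\<phi> has_derivative (\<lambda>h. 0)) (at x)"
  proof (rule has_derivative_transform_within_open[of "\<lambda>_. 0" _ _ _ "- closure {x. \<phi> x \<noteq> 0}"])
    show "0 = \<phi> y" if "y \<in> - closure {x. \<phi> x \<noteq> 0}" for y
      using that closure_subset[of "{x. \<phi> x \<noteq> 0}"] by auto
  qed (use assms in auto)
  then have "frechet_derivative \<phi> (at x) = (\<lambda>h. 0)"
    by (rule frechet_derivative_at[symmetric])
  then show ?thesis
    by (simp add: classical_grad_def vec_eq_iff)
qed

lemma locally_integrable_linear_combination:
  assumes "locally_integrable \<Omega> f" "locally_integrable \<Omega> f'"
  shows "locally_integrable \<Omega> (\<lambda>x. a *\<^sub>R f x + b *\<^sub>R f' x)"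
  using assms unfolding locally_integrable_def
  by (auto intro!: set_integral_add absolutely_integrable_scaleR_left)

text \<open>Serves to show that the extrapolated velocity has a weak gradient, which makes its shear
  rate measurable.\<close>

lemma weak_gradient_linear_combination:
  assumes \<Omega>: "open \<Omega>" and g: "weak_gradient \<Omega> f g" and g': "weak_gradient \<Omega> f' g'"
  shows "weak_gradient \<Omega> (\<lambda>x. a *\<^sub>R f x + b *\<^sub>R f' x) (\<lambda>x. a *\<^sub>R g x + b *\<^sub>R g' x)"
  unfolding weak_gradient_def
proof (intro conjI ballI)
  show "locally_integrable \<Omega> (\<lambda>x. a *\<^sub>R f x + b *\<^sub>R f' x)"
    "locally_integrable \<Omega> (\<lambda>x. a *\<^sub>R g x + b *\<^sub>R g' x)"
    using g g' locally_integrable_linear_combination unfolding weak_gradient_def by blast+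
  fix \<phi> assume \<phi>: "\<phi> \<in> test_functions \<Omega>"
  let ?K = "closure {x. \<phi> x \<noteq> 0}"
  have K: "compact ?K" "?K \<subseteq> \<Omega>"
    using \<phi> by (auto simp: test_functions_def)
  have cont: "continuous_on UNIV \<phi>"
    using \<phi> by (auto simp: test_functions_def dest: spec[of _ 0])
  \<comment> \<open>The product lemma puts the continuous factor first, hence the bilinear map with
    swapped arguments.\<close>
  have int: "integrable (lebesgue_on \<Omega>) (\<lambda>x. F x *\<^sub>R classical_grad \<phi> x)"
    if "locally_integrable \<Omega> F" for F
    by (rule locally_integrable_product[OF that \<Omega> _ continuous_on_classical_grad[OF \<phi>] K,
          where H = "\<lambda>x y. y *\<^sub>R x"])
      (auto simp: classical_grad_eq_0 bilinear_def linear_iff algebra_simps)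
  have int': "integrable (lebesgue_on \<Omega>) (\<lambda>x. \<phi> x *\<^sub>R F x)"
    if "locally_integrable \<Omega> F" for F :: "real^'a \<Rightarrow> real^'a"
    by (rule locally_integrable_product[OF that \<Omega> _ cont K, where H = "\<lambda>x y. x *\<^sub>R y"])
      (use closure_subset in \<open>force simp: bilinear_def linear_iff algebra_simps\<close>)+
  have eq: "(LINT x|lebesgue_on \<Omega>. (a *\<^sub>R f x + b *\<^sub>R f' x) *\<^sub>R classical_grad \<phi> x)
      = a *\<^sub>R (LINT x|lebesgue_on \<Omega>. f x *\<^sub>R classical_grad \<phi> x)
        + b *\<^sub>R (LINT x|lebesgue_on \<Omega>. f' x *\<^sub>R classical_grad \<phi> x)"
    using int[of f] int[of f'] g g'
    by (simp add: weak_gradient_def scaleR_add_left flip: scaleR_scaleR)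
  have eq': "(LINT x|lebesgue_on \<Omega>. \<phi> x *\<^sub>R (a *\<^sub>R g x + b *\<^sub>R g' x))
      = a *\<^sub>R (LINT x|lebesgue_on \<Omega>. \<phi> x *\<^sub>R g x) + b *\<^sub>R (LINT x|lebesgue_on \<Omega>. \<phi> x *\<^sub>R g' x)"
  proof -
    have "\<phi> x *\<^sub>R (a *\<^sub>R g x + b *\<^sub>R g' x) = a *\<^sub>R (\<phi> x *\<^sub>R g x) + b *\<^sub>R (\<phi> x *\<^sub>R g' x)" for x
      by (simp add: scaleR_add_right mult.commute)
    then show ?thesis
      using int'[of g] int'[of g'] g g' by (simp add: weak_gradient_def del: scaleR_scaleR)
  qed
  show "(LINT x|lebesgue_on \<Omega>. (a *\<^sub>R f x + b *\<^sub>R f' x) *\<^sub>R classical_grad \<phi> x)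
      = - (LINT x|lebesgue_on \<Omega>. \<phi> x *\<^sub>R (a *\<^sub>R g x + b *\<^sub>R g' x))"
    unfolding eq eq' using g g' \<phi> by (simp add: weak_gradient_def)
qed

section \<open>Measurability of gradients, shear rates and viscosities\<close>

lemma borel_measurable_wgrad:
  assumes "weak_gradient \<Omega> f g"
  shows "wgrad \<Omega> f \<in> borel_measurable (lebesgue_on \<Omega>)"
proof -
  \<comment> \<open>The representative picked by \<open>SOME\<close> is a weak gradient as soon as
    one exists.\<close>
  have "weak_gradient \<Omega> f (wgrad \<Omega> f)"
    unfolding wgrad_def using assms by (rule someI[of "weak_gradient \<Omega> f"])
  then show ?thesis
    by (simp add: weak_gradient_def locally_integrable_def)
qed

lemma borel_measurable_vgrad:
  assumes "\<And>i. \<exists>g. weak_gradient \<Omega> (\<lambda>x. u x $ i) g"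
  shows "vgrad \<Omega> u \<in> borel_measurable (lebesgue_on \<Omega>)"
proof -
  have "(\<lambda>x. vgrad \<Omega> u x $ i) \<in> borel_measurable (lebesgue_on \<Omega>)" for i
    using assms[of i] borel_measurable_wgrad by (auto simp: vgrad_def eta_contract_eq)
  then show ?thesis
    by (simp add: borel_measurable_vec_nth_iff[of "vgrad \<Omega> u"])
qed

lemma borel_measurable_shear_rate:
  assumes "vgrad \<Omega> u \<in> borel_measurable (lebesgue_on \<Omega>)"
  shows "shear_rate \<Omega> u \<in> borel_measurable (lebesgue_on \<Omega>)"
proof -
  note [measurable] = assms borel_measurable_transpose[OF assms]
  show ?thesis
    unfolding shear_rate_def[abs_def] sym_grad_def by measurable
qed

text \<open>The law \<open>\<eta>\<close> is controlled only on the nonnegative reals; the shear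
  rate, being a square root of a square, stays there.\<close>

lemma viscosity_field_rheological:
  assumes meas: "\<eta> \<in> borel_measurable (restrict_space borel {0..})"
    and range: "\<forall>s\<ge>0. \<nu>min \<le> \<eta> s \<and> \<eta> s \<le> \<nu>max"
    and grad: "\<And>i. \<exists>g. weak_gradient \<Omega> (\<lambda>x. u x $ i) g"
  shows "viscosity_field \<Omega> \<nu>min \<nu>max (\<lambda>x. \<eta> (shear_rate \<Omega> u x))"
  unfolding viscosity_field_def
proof
  have nonneg: "0 \<le> shear_rate \<Omega> u x" for x
    by (simp add: shear_rate_def)
  have "shear_rate \<Omega> u \<in> lebesgue_on \<Omega> \<rightarrow>\<^sub>M restrict_space borel {0..}"
    using nonneg by (intro measurable_restrict_space2 borel_measurable_shear_rate borel_measurable_vgrad grad) auto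
  then show "(\<lambda>x. \<eta> (shear_rate \<Omega> u x)) \<in> borel_measurable (lebesgue_on \<Omega>)"
    using meas by (rule measurable_compose)
  show "AE x in lebesgue_on \<Omega>. \<nu>min \<le> \<eta> (shear_rate \<Omega> u x) \<and> \<eta> (shear_rate \<Omega> u x) \<le> \<nu>max"
    using range nonneg by simp
qed

text \<open>Everything is read off from the inclusion of the components in \<open>H10_space\<close>,
  except continuity, which later bounds the convecting velocity.\<close>

lemma velocity_spaceD:
  assumes "v \<in> velocity_space M \<Omega>"
  shows "continuous_on (closure \<Omega>) v" "v \<in> L2_space \<Omega>" "vgrad \<Omega> v \<in> L2_space \<Omega>"
    "\<exists>g. weak_gradient \<Omega> (\<lambda>x. v x $ i) g"
proof -
  have H1: "(\<lambda>x. v x $ j) \<in> H1_space \<Omega>" for j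
    using assms by (simp add: velocity_space_def H10_space_def)
  show "continuous_on (closure \<Omega>) v"
    using assms by (simp add: velocity_space_def)
  show "v \<in> L2_space \<Omega>"
    using H1 by (intro L2_space_vec) (simp add: H1_space_def)
  have "(\<lambda>x. vgrad \<Omega> v x $ j) \<in> L2_space \<Omega>" for j
    using H1[of j] by (simp add: H1_space_def vgrad_def eta_contract_eq)
  then show "vgrad \<Omega> v \<in> L2_space \<Omega>"
    by (rule L2_space_vec)
  show "\<exists>g. weak_gradient \<Omega> (\<lambda>x. v x $ i) g"
    using H1[of i] by (simp add: H1_space_def)
qed

section \<open>Energy balance of one BDF2 step\<close>

lemma l2_inner_add_left:
  assumes "f \<in> L2_space \<Omega>" "g \<in> L2_space \<Omega>" "h \<in> L2_space \<Omega>"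
  shows "l2_inner \<Omega> (\<lambda>x. f x + g x) h = l2_inner \<Omega> f h + l2_inner \<Omega> g h"
  using assms by (simp add: l2_inner_def inner_add_left L2_space_integrable_inner)

lemma l2_inner_diff_left:
  assumes "f \<in> L2_space \<Omega>" "g \<in> L2_space \<Omega>" "h \<in> L2_space \<Omega>"
  shows "l2_inner \<Omega> (\<lambda>x. f x - g x) h = l2_inner \<Omega> f h - l2_inner \<Omega> g h"
  using assms by (simp add: l2_inner_def inner_diff_left L2_space_integrable_inner)

lemma l2_inner_scaleR_left: "l2_inner \<Omega> (\<lambda>x. c *\<^sub>R f x) h = c * l2_inner \<Omega> f h"
  by (simp add: l2_inner_def)

lemma l2_inner_commute: "l2_inner \<Omega> f g = l2_inner \<Omega> g f"
  by (simp add: l2_inner_def inner_commute)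

text \<open>Used twice: with \<open>g\<close> a viscosity gradient for the forcing, and with
  \<open>g\<close> the extrapolated velocity for the convective term.\<close>

lemma L2_space_matrix_vector_mult:
  fixes A :: "'a::euclidean_space \<Rightarrow> real^'n^'m"
  assumes A: "A \<in> L2_space \<Omega>" and g: "g \<in> borel_measurable (lebesgue_on \<Omega>)"
    and bound: "AE x in lebesgue_on \<Omega>. norm (g x) \<le> K"
  shows "(\<lambda>x. A x *v g x) \<in> L2_space \<Omega>"
proof (rule L2_spaceI[OF A])
  show "(\<lambda>x. A x *v g x) \<in> borel_measurable (lebesgue_on \<Omega>)"
    using A g by (simp add: borel_measurable_matrix_vector_mult L2_space_def)
  show "AE x in lebesgue_on \<Omega>. norm (A x *v g x) \<le> K * norm (A x)"
    using bound
  proof eventually_elim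
    case (elim x)
    have "norm (A x *v g x) \<le> norm (A x) * norm (g x)"
      by (rule norm_matrix_vector_mult_le)
    also have "\<dots> \<le> norm (A x) * K"
      by (rule mult_left_mono[OF elim]) simp
    finally show ?case by (simp add: mult.commute)
  qed
qed

lemma L2_space_transpose:
  fixes A :: "'a::euclidean_space \<Rightarrow> real^'n^'m"
  shows "A \<in> L2_space \<Omega> \<Longrightarrow> (\<lambda>x. transpose (A x)) \<in> L2_space \<Omega>"
  by (rule L2_spaceI[where K = 1 and g = A]) (auto simp: L2_space_def norm_transpose borel_measurable_transpose)

lemma L2_space_sqrt_viscosity:
  assumes n: "viscosity_field \<Omega> \<nu>min \<nu>max n" and A: "A \<in> L2_space \<Omega>" and pos: "0 < \<nu>min"
  shows "(\<lambda>x. sqrt (n x) *\<^sub>R A x) \<in> L2_space \<Omega>"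
proof (rule L2_spaceI[OF A])
  show "(\<lambda>x. sqrt (n x) *\<^sub>R A x) \<in> borel_measurable (lebesgue_on \<Omega>)"
    using n A by (auto simp: viscosity_field_def L2_space_def)
  have "AE x in lebesgue_on \<Omega>. \<nu>min \<le> n x \<and> n x \<le> \<nu>max"
    using n by (simp add: viscosity_field_def)
  then show "AE x in lebesgue_on \<Omega>. norm (sqrt (n x) *\<^sub>R A x) \<le> sqrt \<nu>max * norm (A x)"
    by eventually_elim (use pos in \<open>auto intro!: mult_right_mono\<close>)
qed

text \<open>Positivity of the viscosity matters here: the square of \<open>sqrt (n x)\<close> is the
  absolute value of \<open>n x\<close>, equal to \<open>n x\<close> almost everywhere.\<close>

lemma l2_inner_viscosity:
  assumes n: "viscosity_field \<Omega> \<nu>min \<nu>max n" and A: "A \<in> L2_space \<Omega>" and pos: "0 < \<nu>min"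
  shows "l2_inner \<Omega> (\<lambda>x. n x *\<^sub>R A x) A = (l2_norm \<Omega> (\<lambda>x. sqrt (n x) *\<^sub>R A x))\<^sup>2"
proof -
  have "(LINT x|lebesgue_on \<Omega>. (n x *\<^sub>R A x) \<bullet> A x) = (LINT x|lebesgue_on \<Omega>. (norm (sqrt (n x) *\<^sub>R A x))\<^sup>2)"
  proof (rule integral_cong_AE)
    have "AE x in lebesgue_on \<Omega>. \<nu>min \<le> n x \<and> n x \<le> \<nu>max"
      using n by (simp add: viscosity_field_def)
    then show "AE x in lebesgue_on \<Omega>. (n x *\<^sub>R A x) \<bullet> A x = (norm (sqrt (n x) *\<^sub>R A x))\<^sup>2"
      by eventually_elim (use pos in \<open>auto simp: power_mult_distrib power2_norm_eq_inner\<close>)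
  qed (use n A in \<open>auto simp: viscosity_field_def L2_space_def intro!: borel_measurable_inner\<close>)
  then show ?thesis
    by (simp add: l2_inner_def l2_norm_power2)
qed

section \<open>Algebra of the BDF2 form\<close>

text \<open>The G-stability identity of BDF2, with \<open>v\<close>, \<open>b\<close>,
  \<open>c\<close> the velocities at levels n + 1, n, n - 1. Then \<open>2 *\<^sub>R b - c\<close>
  is the extrapolation to level n + 1 and \<open>2 *\<^sub>R v - b\<close> the one to level n +
  2.\<close>

lemma bdf2_identity:
  fixes b c v :: "'a::real_inner"
  shows "(norm v)\<^sup>2 + (norm (2 *\<^sub>R v - b))\<^sup>2 + (norm (v - (2 *\<^sub>R b - c)))\<^sup>2
       = (norm b)\<^sup>2 + (norm (2 *\<^sub>R b - c))\<^sup>2 + 2 * ((3 *\<^sub>R v - (4 *\<^sub>R b - c)) \<bullet> v)"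
  by (simp only: power2_norm_eq_inner) (simp add: inner_simps inner_commute algebra_simps)

text \<open>The gap between the two sides is a sum of two squares in which the mixed terms of
  \<open>b\<close> and \<open>q\<close> cancel. Equality holds for b = 6/5 v and q = 3/5 v, so the
  factor 2/3 cannot be lowered while 3 is kept.\<close>

lemma bdf2_coercive:
  fixes b c v :: "'a::real_inner"
  shows "3 * (norm v)\<^sup>2 \<le> (norm v)\<^sup>2 + (norm (2 *\<^sub>R v - b))\<^sup>2 + (norm (v - (2 *\<^sub>R b - c)))\<^sup>2
           + 2/3 * ((norm b)\<^sup>2 + (norm (2 *\<^sub>R b - c))\<^sup>2)"
proof -
  define q where "q = 2 *\<^sub>R b - c"
  have "(norm v)\<^sup>2 + (norm (2 *\<^sub>R v - b))\<^sup>2 + (norm (v - q))\<^sup>2 + 2/3 * ((norm b)\<^sup>2 + (norm q)\<^sup>2)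
      = 3 * (norm v)\<^sup>2 + 1/3 * ((norm (3 *\<^sub>R v - 2 *\<^sub>R b - q))\<^sup>2 + (norm (b - 2 *\<^sub>R q))\<^sup>2)"
    by (simp only: power2_norm_eq_inner) (simp add: inner_simps inner_commute field_simps)
  also have "\<dots> \<ge> 3 * (norm v)\<^sup>2"
    by simp
  finally show ?thesis
    unfolding q_def .
qed

section \<open>Young's inequality and the explicit forcing\<close>

lemma young_ineq:
  fixes a c p x y :: real
  assumes "0 \<le> a" "0 \<le> c" "0 \<le> p" "p\<^sup>2 = 4 * a * c"
  shows "p * x * y \<le> a * x\<^sup>2 + c * y\<^sup>2"
proof -
  \<comment> \<open>Fixing \<open>p\<close> through its square avoids division, so \<open>a\<close>
    or \<open>c\<close> may be zero.\<close>
  have p: "p = 2 * sqrt a * sqrt c"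
    using assms by (intro power2_eq_imp_eq[of p]) (auto simp: power_mult_distrib)
  have "0 \<le> (sqrt a * x - sqrt c * y)\<^sup>2" by simp
  also have "\<dots> = (sqrt a)\<^sup>2 * x\<^sup>2 + (sqrt c)\<^sup>2 * y\<^sup>2 - p * x * y"
    unfolding p by (simp add: power2_eq_square algebra_simps)
  finally show ?thesis using assms by simp
qed

text \<open>The forcing vector has norm at most \<open>t * G\<close>, and Young's inequality splits
  the product with \<open>v\<close>. The condition on \<open>a * b\<close> is exactly the
  discriminant condition for the coefficient \<open>4 * b * \<epsilon> * \<tau> * \<nu>min\<close>
  of \<open>t\<^sup>2\<close>; expanding \<open>t\<^sup>2\<close> turns this coefficient into the
  constants 32 and 8.\<close>

lemma forcing_bound_pointwise:
  fixes A0 A1 :: "real^'n^'n" and g0 g1 v :: "real^'n"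
  assumes g: "norm g0 \<le> G" "norm g1 \<le> G" and n: "\<nu>min \<le> n0" "\<nu>min \<le> n1"
    and pos: "0 < \<nu>min" "0 < \<epsilon>" "0 \<le> \<tau>" "0 \<le> a" "0 \<le> b" and ab: "a * b * (\<epsilon> * \<nu>min) = \<tau> * G\<^sup>2"
  shows "4 * \<tau> * ((2 *\<^sub>R (transpose A1 *v g1) - transpose A0 *v g0) \<bullet> v)
       \<le> a * (norm v)\<^sup>2 + b * (32 * \<epsilon> * \<tau> * (n1 * (norm A1)\<^sup>2) + 8 * \<epsilon> * \<tau> * (n0 * (norm A0)\<^sup>2))"
proof -
  have G: "0 \<le> G" using g(1) norm_ge_zero order_trans by blast
  define t where "t = 2 * norm A1 + norm A0"
  have mult: "norm (transpose A *v g) \<le> norm A * G" if "norm g \<le> G" for A :: "real^'n^'n" and g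
    using norm_matrix_vector_mult_le[of "transpose A" g] mult_left_mono[OF that, of "norm A"]
    by (simp add: norm_transpose)
  have "norm (2 *\<^sub>R (transpose A1 *v g1) - transpose A0 *v g0)
      \<le> norm (2 *\<^sub>R (transpose A1 *v g1)) + norm (transpose A0 *v g0)"
    by (rule norm_triangle_ineq4)
  also have "\<dots> \<le> t * G"
    using mult[OF g(1), of A0] mult[OF g(2), of A1] by (simp add: t_def algebra_simps)
  finally have "(2 *\<^sub>R (transpose A1 *v g1) - transpose A0 *v g0) \<bullet> v \<le> t * G * norm v"
    using norm_cauchy_schwarz order_trans mult_right_mono norm_ge_zero by meson
  then have "4 * \<tau> * ((2 *\<^sub>R (transpose A1 *v g1) - transpose A0 *v g0) \<bullet> v) \<le> 4 * \<tau> * (t * G * norm v)"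
    using pos by (intro mult_left_mono) auto
  also have "\<dots> = (4 * \<tau> * G) * norm v * t"
    by simp
  also have "\<dots> \<le> a * (norm v)\<^sup>2 + (4 * b * \<epsilon> * \<tau> * \<nu>min) * t\<^sup>2"
  proof (rule young_ineq)
    have "(4 * \<tau> * G)\<^sup>2 = 16 * \<tau> * (\<tau> * G\<^sup>2)" by (simp add: power2_eq_square)
    also have "\<dots> = 4 * a * (4 * b * \<epsilon> * \<tau> * \<nu>min)" by (simp add: ab[symmetric])
    finally show "(4 * \<tau> * G)\<^sup>2 = 4 * a * (4 * b * \<epsilon> * \<tau> * \<nu>min)" .
  qed (use pos G in auto)
  also have "(4 * b * \<epsilon> * \<tau> * \<nu>min) * t\<^sup>2 \<le> (4 * b * \<epsilon> * \<tau> * \<nu>min) * (8 * (norm A1)\<^sup>2 + 2 * (norm A0)\<^sup>2)"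
  proof (rule mult_left_mono)
    show "t\<^sup>2 \<le> 8 * (norm A1)\<^sup>2 + 2 * (norm A0)\<^sup>2"
      using zero_le_power2[of "2 * norm A1 - norm A0"] by (simp add: t_def power2_eq_square algebra_simps)
  qed (use pos in auto)
  also have "\<dots> = b * (32 * \<epsilon> * \<tau> * (\<nu>min * (norm A1)\<^sup>2) + 8 * \<epsilon> * \<tau> * (\<nu>min * (norm A0)\<^sup>2))"
    by (simp add: algebra_simps)
  \<comment> \<open>The constant weight is traded for the viscosities that occur in the
    energy.\<close>
  also have "\<dots> \<le> b * (32 * \<epsilon> * \<tau> * (n1 * (norm A1)\<^sup>2) + 8 * \<epsilon> * \<tau> * (n0 * (norm A0)\<^sup>2))"
    using pos n by (intro mult_left_mono add_mono mult_right_mono) auto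
  finally show ?thesis by simp
qed

text \<open>The weights \<open>n0\<close>, \<open>n1\<close> are not tied to the fields whose
  gradients are \<open>g0\<close>, \<open>g1\<close>: in the application the former are extrapolated
  viscosities and the latter come from the viscosities themselves.\<close>

lemma forcing_bound:
  fixes A0 A1 :: "real^'n \<Rightarrow> real^'n^'n" and v g0 g1 :: "real^'n \<Rightarrow> real^'n"
  assumes L2: "A0 \<in> L2_space \<Omega>" "A1 \<in> L2_space \<Omega>" "v \<in> L2_space \<Omega>"
    and g: "g0 \<in> borel_measurable (lebesgue_on \<Omega>)" "g1 \<in> borel_measurable (lebesgue_on \<Omega>)"
      "AE x in lebesgue_on \<Omega>. norm (g0 x) \<le> G" "AE x in lebesgue_on \<Omega>. norm (g1 x) \<le> G"
    and n: "viscosity_field \<Omega> \<nu>min \<nu>max n0" "viscosity_field \<Omega> \<nu>min \<nu>max n1"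
    and pos: "0 < \<nu>min" "0 < \<epsilon>" "0 \<le> \<tau>" "0 \<le> a" "0 \<le> b" and ab: "a * b * (\<epsilon> * \<nu>min) = \<tau> * G\<^sup>2"
  shows "4 * \<tau> * l2_inner \<Omega> (\<lambda>x. 2 *\<^sub>R (transpose (A1 x) *v g1 x) - transpose (A0 x) *v g0 x) v
       \<le> a * (l2_norm \<Omega> v)\<^sup>2 + b * (32 * \<epsilon> * \<tau> * (l2_norm \<Omega> (\<lambda>x. sqrt (n1 x) *\<^sub>R A1 x))\<^sup>2
                                  + 8 * \<epsilon> * \<tau> * (l2_norm \<Omega> (\<lambda>x. sqrt (n0 x) *\<^sub>R A0 x))\<^sup>2)"
    (is "_ * l2_inner \<Omega> ?F v \<le> _")
proof -
  have F: "?F \<in> L2_space \<Omega>"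
    by (intro L2_space_diff L2_space_scaleR L2_space_matrix_vector_mult[where K = G]
        L2_space_transpose L2 g)
  have int: "integrable (lebesgue_on \<Omega>) (\<lambda>x. (norm (v x))\<^sup>2)"
      "integrable (lebesgue_on \<Omega>) (\<lambda>x. (norm (sqrt (n0 x) *\<^sub>R A0 x))\<^sup>2)"
      "integrable (lebesgue_on \<Omega>) (\<lambda>x. (norm (sqrt (n1 x) *\<^sub>R A1 x))\<^sup>2)"
    using L2(3) L2_space_sqrt_viscosity[OF n(1) L2(1) pos(1)] L2_space_sqrt_viscosity[OF n(2) L2(2) pos(1)]
    unfolding L2_space_def by blast+
  have "AE x in lebesgue_on \<Omega>. \<nu>min \<le> n0 x" "AE x in lebesgue_on \<Omega>. \<nu>min \<le> n1 x"
    using n by (auto simp: viscosity_field_def)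
  then have le: "AE x in lebesgue_on \<Omega>. 4 * \<tau> * (?F x \<bullet> v x) \<le> a * (norm (v x))\<^sup>2
      + b * (32 * \<epsilon> * \<tau> * (norm (sqrt (n1 x) *\<^sub>R A1 x))\<^sup>2 + 8 * \<epsilon> * \<tau> * (norm (sqrt (n0 x) *\<^sub>R A0 x))\<^sup>2)"
    using g(3,4)
  proof eventually_elim
    case (elim x)
    then show ?case
      using forcing_bound_pointwise[OF elim(3,4,1,2) pos ab] pos(1) by (simp add: power_mult_distrib)
  qed
  have "(LINT x|lebesgue_on \<Omega>. 4 * \<tau> * (?F x \<bullet> v x)) \<le> (LINT x|lebesgue_on \<Omega>. a * (norm (v x))\<^sup>2
      + b * (32 * \<epsilon> * \<tau> * (norm (sqrt (n1 x) *\<^sub>R A1 x))\<^sup>2 + 8 * \<epsilon> * \<tau> * (norm (sqrt (n0 x) *\<^sub>R A0 x))\<^sup>2))"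
    by (intro integral_mono_AE le Bochner_Integration.integrable_add
        Bochner_Integration.integrable_mult_right int L2_space_integrable_inner[OF F L2(3)])
  then show ?thesis
    using int by (simp add: l2_inner_def l2_norm_power2 del: norm_scaleR)
qed

lemma bdf2_l2_identity:
  assumes "b \<in> L2_space \<Omega>" "c \<in> L2_space \<Omega>" "v \<in> L2_space \<Omega>"
  shows "(l2_norm \<Omega> v)\<^sup>2 + (l2_norm \<Omega> (\<lambda>x. 2 *\<^sub>R v x - b x))\<^sup>2
         + (l2_norm \<Omega> (\<lambda>x. v x - (2 *\<^sub>R b x - c x)))\<^sup>2
       = (l2_norm \<Omega> b)\<^sup>2 + (l2_norm \<Omega> (\<lambda>x. 2 *\<^sub>R b x - c x))\<^sup>2
         + 2 * l2_inner \<Omega> (\<lambda>x. 3 *\<^sub>R v x - (4 *\<^sub>R b x - c x)) v" (is ?id)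
    and "3 * (l2_norm \<Omega> v)\<^sup>2 \<le> (l2_norm \<Omega> v)\<^sup>2 + (l2_norm \<Omega> (\<lambda>x. 2 *\<^sub>R v x - b x))\<^sup>2
         + (l2_norm \<Omega> (\<lambda>x. v x - (2 *\<^sub>R b x - c x)))\<^sup>2
         + 2/3 * ((l2_norm \<Omega> b)\<^sup>2 + (l2_norm \<Omega> (\<lambda>x. 2 *\<^sub>R b x - c x))\<^sup>2)" (is ?coercive)
proof -
  have sq: "integrable (lebesgue_on \<Omega>) (\<lambda>x. (norm (f x))\<^sup>2)" if "f \<in> L2_space \<Omega>" for f :: "'a \<Rightarrow> 'b"
    using that by (simp add: L2_space_def)
  have int: "integrable (lebesgue_on \<Omega>) (\<lambda>x. (norm (v x))\<^sup>2)"
    "integrable (lebesgue_on \<Omega>) (\<lambda>x. (norm (b x))\<^sup>2)"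
    "integrable (lebesgue_on \<Omega>) (\<lambda>x. (norm (2 *\<^sub>R v x - b x))\<^sup>2)"
    "integrable (lebesgue_on \<Omega>) (\<lambda>x. (norm (2 *\<^sub>R b x - c x))\<^sup>2)"
    "integrable (lebesgue_on \<Omega>) (\<lambda>x. (norm (v x - (2 *\<^sub>R b x - c x)))\<^sup>2)"
    by (intro sq L2_space_diff L2_space_scaleR assms)+
  have inner: "integrable (lebesgue_on \<Omega>) (\<lambda>x. (3 *\<^sub>R v x - (4 *\<^sub>R b x - c x)) \<bullet> v x)"
    by (intro L2_space_integrable_inner L2_space_diff L2_space_scaleR assms)
  have "(LINT x|lebesgue_on \<Omega>. (norm (v x))\<^sup>2 + (norm (2 *\<^sub>R v x - b x))\<^sup>2 + (norm (v x - (2 *\<^sub>R b x - c x)))\<^sup>2)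
      = (LINT x|lebesgue_on \<Omega>. (norm (b x))\<^sup>2 + (norm (2 *\<^sub>R b x - c x))\<^sup>2
           + 2 * ((3 *\<^sub>R v x - (4 *\<^sub>R b x - c x)) \<bullet> v x))"
    by (simp only: bdf2_identity)
  then show ?id
    using int inner by (simp add: l2_norm_power2 l2_inner_def)
  have "(LINT x|lebesgue_on \<Omega>. 3 * (norm (v x))\<^sup>2) \<le> (LINT x|lebesgue_on \<Omega>. (norm (v x))\<^sup>2
      + (norm (2 *\<^sub>R v x - b x))\<^sup>2 + (norm (v x - (2 *\<^sub>R b x - c x)))\<^sup>2
      + 2/3 * ((norm (b x))\<^sup>2 + (norm (2 *\<^sub>R b x - c x))\<^sup>2))"
    by (intro integral_mono bdf2_coercive Bochner_Integration.integrable_add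
        Bochner_Integration.integrable_mult_right int)
  then show ?coercive
    using int by (simp add: l2_norm_power2)
qed

text \<open>Here \<open>W\<close> is the convective term, which the skew symmetry removes. What
  remains of the tested equation is combined with the integrated BDF2 identity.\<close>

lemma energy_balance:
  fixes A0 A1 A2 :: "real^'n \<Rightarrow> real^'n^'n" and b c v g0 g1 W :: "real^'n \<Rightarrow> real^'n"
  assumes L2: "A0 \<in> L2_space \<Omega>" "A1 \<in> L2_space \<Omega>" "A2 \<in> L2_space \<Omega>"
      "b \<in> L2_space \<Omega>" "c \<in> L2_space \<Omega>" "v \<in> L2_space \<Omega>" "W \<in> L2_space \<Omega>"
    and g: "g0 \<in> borel_measurable (lebesgue_on \<Omega>)" "g1 \<in> borel_measurable (lebesgue_on \<Omega>)"
      "AE x in lebesgue_on \<Omega>. norm (g0 x) \<le> G" "AE x in lebesgue_on \<Omega>. norm (g1 x) \<le> G"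
    and n2: "viscosity_field \<Omega> \<nu>min \<nu>max n2" and pos: "0 < \<nu>min" "0 < \<tau>"
    and skew: "l2_inner \<Omega> W v = 0"
    and tested: "l2_inner \<Omega> (\<lambda>x. (3 / (2 * \<tau>)) *\<^sub>R v x + W x) v + l2_inner \<Omega> (\<lambda>x. n2 x *\<^sub>R A2 x) A2
      = l2_inner \<Omega> (\<lambda>x. (1 / (2 * \<tau>)) *\<^sub>R (4 *\<^sub>R b x - c x)
          + 2 *\<^sub>R (transpose (A1 x) *v g1 x) - transpose (A0 x) *v g0 x) v"
  shows "(l2_norm \<Omega> v)\<^sup>2 + (l2_norm \<Omega> (\<lambda>x. 2 *\<^sub>R v x - b x))\<^sup>2
         + (l2_norm \<Omega> (\<lambda>x. v x - (2 *\<^sub>R b x - c x)))\<^sup>2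
         + 4 * \<tau> * (l2_norm \<Omega> (\<lambda>x. sqrt (n2 x) *\<^sub>R A2 x))\<^sup>2
       = (l2_norm \<Omega> b)\<^sup>2 + (l2_norm \<Omega> (\<lambda>x. 2 *\<^sub>R b x - c x))\<^sup>2
         + 4 * \<tau> * l2_inner \<Omega> (\<lambda>x. 2 *\<^sub>R (transpose (A1 x) *v g1 x) - transpose (A0 x) *v g0 x) v"
    (is "_ = _ + _ * l2_inner \<Omega> ?F v")
proof -
  have F: "?F \<in> L2_space \<Omega>"
    by (intro L2_space_diff L2_space_scaleR L2_space_matrix_vector_mult[where K = G]
        L2_space_transpose L2 g)
  have bc: "(\<lambda>x. 4 *\<^sub>R b x - c x) \<in> L2_space \<Omega>"
    by (intro L2_space_diff L2_space_scaleR L2)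
  have "l2_inner \<Omega> (\<lambda>x. (3 / (2 * \<tau>)) *\<^sub>R v x + W x) v = 3 / (2 * \<tau>) * l2_inner \<Omega> v v"
    using L2 skew by (simp add: l2_inner_add_left l2_inner_scaleR_left L2_space_scaleR)
  moreover have "l2_inner \<Omega> (\<lambda>x. (1 / (2 * \<tau>)) *\<^sub>R (4 *\<^sub>R b x - c x) + ?F x) v
      = 1 / (2 * \<tau>) * l2_inner \<Omega> (\<lambda>x. 4 *\<^sub>R b x - c x) v + l2_inner \<Omega> ?F v"
    using l2_inner_add_left[OF L2_space_scaleR[OF bc, of "1 / (2 * \<tau>)"] F L2(6)]
    by (simp only: l2_inner_scaleR_left)
  ultimately have "3 / (2 * \<tau>) * l2_inner \<Omega> v v + (l2_norm \<Omega> (\<lambda>x. sqrt (n2 x) *\<^sub>R A2 x))\<^sup>2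
      = 1 / (2 * \<tau>) * l2_inner \<Omega> (\<lambda>x. 4 *\<^sub>R b x - c x) v + l2_inner \<Omega> ?F v"
    using tested l2_inner_viscosity[OF n2 L2(3) pos(1)] by (simp add: add_diff_eq)
  \<comment> \<open>The factor \<open>4 * \<tau>\<close> turns the time-difference coefficients into
    6 and 2, matching twice the inner product in the BDF2 identity.\<close>
  then have "4 * \<tau> * (3 / (2 * \<tau>) * l2_inner \<Omega> v v + (l2_norm \<Omega> (\<lambda>x. sqrt (n2 x) *\<^sub>R A2 x))\<^sup>2)
      = 4 * \<tau> * (1 / (2 * \<tau>) * l2_inner \<Omega> (\<lambda>x. 4 *\<^sub>R b x - c x) v + l2_inner \<Omega> ?F v)"
    by (rule arg_cong)
  then have "6 * l2_inner \<Omega> v v + 4 * \<tau> * (l2_norm \<Omega> (\<lambda>x. sqrt (n2 x) *\<^sub>R A2 x))\<^sup>2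
      = 2 * l2_inner \<Omega> (\<lambda>x. 4 *\<^sub>R b x - c x) v + 4 * \<tau> * l2_inner \<Omega> ?F v"
    using pos by (simp add: distrib_left)
  moreover have "l2_inner \<Omega> (\<lambda>x. 3 *\<^sub>R v x - (4 *\<^sub>R b x - c x)) v
      = 3 * l2_inner \<Omega> v v - l2_inner \<Omega> (\<lambda>x. 4 *\<^sub>R b x - c x) v"
    by (subst l2_inner_diff_left[OF L2_space_scaleR[OF L2(6)] bc L2(6)]) (simp add: l2_inner_scaleR_left)
  ultimately show ?thesis
    using bdf2_l2_identity(1)[OF L2(4,5,6)] by simp
qed

section \<open>Growth over one time step\<close>

text \<open>The Lagrange remainder is nonnegative for nonnegative \<open>x\<close>.\<close>

lemma exp_ge_partial_sum:
  fixes x :: real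
  assumes "0 \<le> x"
  shows "(\<Sum>m<n. x ^ m / fact m) \<le> exp x"
proof -
  obtain t where "exp x = (\<Sum>m<n. x ^ m / fact m) + exp t / fact n * x ^ n"
    using Maclaurin_exp_le[of x n] by blast
  then show ?thesis using assms by simp
qed

text \<open>Already the cubic Taylor polynomial dominates the left-hand side. After clearing
  \<open>3 - s\<close> the gap is s (4/3 + s/2 - s^3/6), and bounding one factor s^2 by (12/5)^2
  shows that it is nonnegative.\<close>

lemma exp_ge_rational:
  fixes s :: real
  assumes "0 \<le> s" "s \<le> 12/5"
  shows "1 + 5/3 * s / (3 - s) \<le> exp s"
proof -
  have "s\<^sup>2 \<le> (12/5)\<^sup>2"
    using assms by (intro power_mono) auto
  then have "s * s\<^sup>2 \<le> s * (12/5)\<^sup>2"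
    using assms(1) by (rule mult_left_mono)
  then have "0 \<le> s * (4/3 + s/2 - s * s\<^sup>2 / 6)"
    using assms by (intro mult_nonneg_nonneg) (auto simp: power2_eq_square)
  also have "\<dots> = (s + s\<^sup>2/2 + s^3/6) * (3 - s) - 5/3 * s"
    by (simp add: power2_eq_square power3_eq_cube field_simps)
  finally have "5/3 * s \<le> (s + s\<^sup>2/2 + s^3/6) * (3 - s)"
    by simp
  then have "5/3 * s / (3 - s) \<le> s + s\<^sup>2/2 + s^3/6"
    using assms by (subst pos_divide_le_eq) auto
  then show ?thesis
    using exp_ge_partial_sum[OF assms(1), of 4] by (simp add: lessThan_nat_numeral fact_numeral)
qed

text \<open>The right-hand side of the tangent bound \<open>exp s \<ge> exp (12/5) * (s - 7/5)\<close> meets \<open>4 * s\<close>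
  at \<open>s = 12/5\<close> once \<open>exp (12/5)\<close> is replaced by its lower bound \<open>48/5\<close>.\<close>

lemma exp_ge_linear:
  fixes s :: real
  assumes "12/5 \<le> s"
  shows "4 * s \<le> exp s"
proof -
  have "48/5 \<le> exp (12/5 :: real)"
    using exp_ge_partial_sum[of "12/5" 5] by (simp add: lessThan_nat_numeral fact_numeral power_divide)
  then have "48/5 * (1 + (s - 12/5)) \<le> exp (12/5) * exp (s - 12/5)"
    using assms by (intro mult_mono exp_ge_add_one_self) auto
  also have "\<dots> = exp s"
    by (simp flip: exp_add)
  finally show ?thesis using assms by simp
qed

text \<open>For small \<open>s\<close> the choice \<open>a = s\<close>, \<open>b = 1\<close> cancels \<open>R\<close>; for large \<open>s\<close> the choice
  \<open>a = 1/2\<close> keeps the term \<open>a * X\<close> absorbable.\<close>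

lemma one_step_growth:
  fixes s E E' S X Z R :: real
  assumes s: "0 \<le> s" and nonneg: "0 \<le> S" "0 \<le> Z" "0 \<le> R"
    and le: "R \<le> E" "X \<le> E'" and coercive: "3 * X \<le> E' + Z + 2/3 * E"
    and step: "\<And>a b. 0 \<le> a \<Longrightarrow> 0 \<le> b \<Longrightarrow> a * b = s \<Longrightarrow> E' + S + Z \<le> E - R + a * X + b * R"
  shows "E' + S \<le> exp s * E"
proof (cases "s \<le> 12/5")
  case True
  have *: "E' + S + Z \<le> E + s * X"
    using step[of s 1] s by simp
  \<comment> \<open>The coercivity bound makes \<open>3 * X\<close> at most
    \<open>E + s * X + 2/3 * E\<close>; the term \<open>s * X\<close> moves to the left because s <
    3.\<close>
  then have "(3 - s) * X \<le> 5/3 * E"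
    using coercive nonneg by (simp add: algebra_simps)
  then have "X \<le> 5/3 * E / (3 - s)"
    using True by (subst pos_le_divide_eq) (auto simp: mult.commute)
  then have "s * X \<le> s * (5/3 * E / (3 - s))"
    using s by (rule mult_left_mono)
  then have "E' + S \<le> (1 + 5/3 * s / (3 - s)) * E"
    using * nonneg by (simp add: algebra_simps)
  also have "\<dots> \<le> exp s * E"
    using exp_ge_rational[OF s True] nonneg le by (intro mult_right_mono) auto
  finally show ?thesis .
next
  case False
  have "E' + S + Z \<le> E - R + X / 2 + 2 * s * R"
    using step[of "1/2" "2 * s"] s by simp
  moreover have "(2 * s - 1) * R \<le> (2 * s - 1) * E"
    using False le by (intro mult_left_mono) auto
  \<comment> \<open>Replacing \<open>R\<close> by \<open>E\<close> leaves
    \<open>2 * s * E + X / 2\<close>. Half of \<open>E'\<close> absorbs \<open>X / 2\<close>, and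
    doubling gives the factor 4.\<close>
  ultimately have "E' + S \<le> 4 * s * E"
    using nonneg le by (simp add: algebra_simps)
  also have "\<dots> \<le> exp s * E"
    using exp_ge_linear[of s] False nonneg le by (intro mult_right_mono) auto
  finally show ?thesis .
qed

section \<open>Stability\<close>

text \<open>Applied to the extrapolated velocity, so that the convective term is
  square-integrable.\<close>

lemma compact_closure_bound:
  fixes v :: "'a::euclidean_space \<Rightarrow> 'b::real_normed_vector"
  assumes "bounded \<Omega>" "continuous_on (closure \<Omega>) v"
  obtains K where "\<And>x. x \<in> \<Omega> \<Longrightarrow> norm (v x) \<le> K"
proof -
  have "bounded (v ` closure \<Omega>)"
    using assms by (intro compact_imp_bounded compact_continuous_image) (simp_all add: compact_closure)
  then obtain K where "\<And>y. y \<in> v ` closure \<Omega> \<Longrightarrow> norm y \<le> K"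
    by (auto simp: bounded_iff)
  then show ?thesis
    using that closure_subset by blast
qed

text \<open>Reduces the prescribed and the rheological case to the two facts that the estimate works
  with, so that the two cases need not be distinguished again.\<close>

lemma viscosity_bounds:
  assumes viscosity: "(\<exists>V. prescribed_viscosity \<Omega> T N \<nu>min \<nu>max V \<nu> \<nu>s G) \<or>
                    (\<exists>\<eta>. rheological_viscosity \<Omega> N \<nu>min \<nu>max \<eta> u \<nu> \<nu>s G)"
    and T: "0 < T" and \<Omega>: "open \<Omega>" and n: "n \<le> N"
    and u: "\<And>n. n \<le> N \<Longrightarrow> u n \<in> velocity_space M \<Omega>"
  shows "viscosity_field \<Omega> \<nu>min \<nu>max (\<nu>s n)"
    and "linf_norm (lebesgue_on \<Omega>) (wgrad \<Omega> (\<nu> n)) \<le> ereal G"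
  using viscosity
proof (atomize (full), elim disjE exE, goal_cases)
  case (1 V)
  have "real n * (T / real N) \<le> real N * (T / real N)"
    using n T by (intro mult_right_mono) auto
  also have "\<dots> \<le> T"
    using T by simp
  finally have "real n * (T / real N) \<in> {0..T}"
    using T by simp
  then show ?case
    using 1 n unfolding prescribed_viscosity_def by metis
next
  case (2 \<eta>)
  have "viscosity_field \<Omega> \<nu>min \<nu>max (\<nu>s n)"
  proof (cases "2 \<le> n")
    case True
    have "\<exists>g. weak_gradient \<Omega> (\<lambda>x. ustar u n x $ i) g" for i
    proof -
      have "n - 1 \<le> N" "n - 2 \<le> N"
        using n by auto
      then obtain g g' where "weak_gradient \<Omega> (\<lambda>x. u (n - 1) x $ i) g" "weak_gradient \<Omega> (\<lambda>x. u (n - 2) x $ i) g'"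
        using velocity_spaceD(4)[OF u] by meson
      then have "weak_gradient \<Omega> (\<lambda>x. 2 *\<^sub>R (u (n - 1) x $ i) + (- 1) *\<^sub>R (u (n - 2) x $ i))
          (\<lambda>x. 2 *\<^sub>R g x + (- 1) *\<^sub>R g' x)"
        by (rule weak_gradient_linear_combination[OF \<Omega>])
      then show ?thesis by (auto simp: ustar_def)
    qed
    moreover have "\<nu>s n = (\<lambda>x. \<eta> (shear_rate \<Omega> (ustar u n) x))"
      using 2 True n by (simp add: rheological_viscosity_def)
    ultimately show ?thesis
      using viscosity_field_rheological[of \<eta> \<nu>min \<nu>max \<Omega> "ustar u n"] 2
      by (simp add: rheological_viscosity_def)
  next
    \<comment> \<open>Extrapolation starts at level 2; at levels 0 and 1 the bounds are part of the
      hypothesis.\<close>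
    case False
    then have "n = 0 \<or> n = 1" by auto
    then show ?thesis
      using 2 by (auto simp: rheological_viscosity_def)
  qed
  moreover have "linf_norm (lebesgue_on \<Omega>) (wgrad \<Omega> (\<nu> n)) \<le> ereal G"
    using 2 n by (auto simp: rheological_viscosity_def intro: SUP_upper)
  ultimately show ?case ..
qed

theorem theorem4p3:
  fixes \<Omega> :: "(real^'d) set"
    and M :: "(cell_shape \<times> (real^'d \<Rightarrow> real^'d)) set"
    and T \<tau> \<nu>min \<nu>max G \<epsilon> C :: real
    and N :: nat
    and u :: "nat \<Rightarrow> real^'d \<Rightarrow> real^'d"
    and p \<nu> \<nu>s :: "nat \<Rightarrow> real^'d \<Rightarrow> real"
  assumes dim: "CARD('d) = 2 \<or> CARD('d) = 3"
    and domain: "lipschitz_domain \<Omega>"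
    and mesh: "mesh_of M \<Omega>"
    and Xh: "Xh = velocity_space M \<Omega>"
    and Yh: "Yh = pressure_space M \<Omega>"
    and time: "T > 0" "N \<ge> 2" "\<tau> = T / real N"
    and bounds: "0 < \<nu>min" "\<nu>min \<le> \<nu>max"
    and viscosity: "(\<exists>V. prescribed_viscosity \<Omega> T N \<nu>min \<nu>max V \<nu> \<nu>s G) \<or>
                    (\<exists>\<eta>. rheological_viscosity \<Omega> N \<nu>min \<nu>max \<eta> u \<nu> \<nu>s G)"
    and regular: "\<And>n. n \<le> N \<Longrightarrow> \<nu> n \<in> W1inf_space \<Omega>"
    and velocities: "\<And>n. n \<le> N \<Longrightarrow> u n \<in> Xh"
    and pressures: "\<And>n. n \<in> {2..N} \<Longrightarrow> p n \<in> Yh"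
    and scheme: "\<And>n. n \<in> {1..N - 1} \<Longrightarrow> imex_step \<Omega> Xh Yh \<tau> \<nu> \<nu>s u p n"
    and skew: "\<And>n. n \<in> {1..N - 1} \<Longrightarrow>
                 l2_inner \<Omega> (\<lambda>x. vgrad \<Omega> (u (n + 1)) x *v ustar u (n + 1) x) (u (n + 1)) = 0"
    and eps: "0 < \<epsilon>" "\<epsilon> \<le> 1 / 10"
    and C: "C = (l2_norm \<Omega> (ustar u 2))\<^sup>2 + (l2_norm \<Omega> (u 1))\<^sup>2
              + 40 * \<tau> * \<epsilon> * (l2_norm \<Omega> (\<lambda>x. sqrt (\<nu>s 1 x) *\<^sub>R vgrad \<Omega> (u 1) x))\<^sup>2
              + 8 * \<epsilon> * \<tau> * (l2_norm \<Omega> (\<lambda>x. sqrt (\<nu>s 0 x) *\<^sub>R vgrad \<Omega> (u 0) x))\<^sup>2"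
  shows "(l2_norm \<Omega> (u N))\<^sup>2 + (l2_norm \<Omega> (ustar u (N + 1)))\<^sup>2
       + 8 * \<epsilon> * \<tau> * (5 * (l2_norm \<Omega> (\<lambda>x. sqrt (\<nu>s N x) *\<^sub>R vgrad \<Omega> (u N) x))\<^sup>2
                      + (l2_norm \<Omega> (\<lambda>x. sqrt (\<nu>s (N - 1) x) *\<^sub>R vgrad \<Omega> (u (N - 1)) x))\<^sup>2)
       + 4 * (1 - 10 * \<epsilon>) * \<tau> *
           (\<Sum>n = 2..N. (l2_norm \<Omega> (\<lambda>x. sqrt (\<nu>s n x) *\<^sub>R vgrad \<Omega> (u n) x))\<^sup>2)
       \<le> C * exp (G\<^sup>2 * T / (\<epsilon> * \<nu>min))"
proof -
  define B where "B n = (l2_norm \<Omega> (u n))\<^sup>2" for n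
  define Q where "Q n = (l2_norm \<Omega> (ustar u (n + 1)))\<^sup>2" for n
  define D where "D n = (l2_norm \<Omega> (\<lambda>x. sqrt (\<nu>s n x) *\<^sub>R vgrad \<Omega> (u n) x))\<^sup>2" for n
  \<comment> \<open>The energy at level n, for n \<ge> 1. Its value at n = 1 is \<open>C\<close>.
    The constant 40 is the share of the dissipation \<open>4 * \<tau> * D n\<close> kept in the
    energy; the share \<open>4 * (1 - 10 * \<epsilon>) * \<tau> * D n\<close> goes to the
    sum.\<close>
  define E where "E n = B n + Q n + 40 * \<epsilon> * \<tau> * D n + 8 * \<epsilon> * \<tau> * D (n - 1)" for n
  define s where "s = \<tau> * G\<^sup>2 / (\<epsilon> * \<nu>min)"
  have \<tau>: "0 < \<tau>" using time by simp
  have s: "0 \<le> s" using \<tau> eps bounds by (simp add: s_def)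
  have \<Omega>: "open \<Omega>" "bounded \<Omega>" using domain by (auto simp: lipschitz_domain_def)
  have nonneg: "0 \<le> B n" "0 \<le> Q n" "0 \<le> D n" for n
    by (simp_all add: B_def Q_def D_def)
  have u: "u n \<in> velocity_space M \<Omega>" if "n \<le> N" for n
    using velocities[OF that] Xh by simp
  note L2 = velocity_spaceD(2)[OF u] velocity_spaceD(3)[OF u]
  have visc: "viscosity_field \<Omega> \<nu>min \<nu>max (\<nu>s n)"
    and "linf_norm (lebesgue_on \<Omega>) (wgrad \<Omega> (\<nu> n)) \<le> ereal G" if "n \<le> N" for n
    using viscosity_bounds[OF viscosity time(1) \<Omega>(1) that u] by auto
  note grad = AE_le_of_linf_norm[OF this(2)]

  have growth: "E (n + 1) + 4 * (1 - 10 * \<epsilon>) * \<tau> * D (n + 1) \<le> exp s * E n" if n: "n \<in> {1..N - 1}" for n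
  proof -
    have le: "n - 1 \<le> N" "n \<le> N" "n + 1 \<le> N" using n time by auto
    define Z where "Z = (l2_norm \<Omega> (\<lambda>x. u (n + 1) x - (2 *\<^sub>R u n x - u (n - 1) x)))\<^sup>2"
    \<comment> \<open>The viscous part of \<open>E n\<close> less the amount
      \<open>8 * \<epsilon> * \<tau> * D n\<close> that reappears in \<open>E (n + 1)\<close>; hence
      32 = 40 - 8, the constant in the forcing bound.\<close>
    define R where "R = 32 * \<epsilon> * \<tau> * D n + 8 * \<epsilon> * \<tau> * D (n - 1)"
    have star: "ustar u (n + 1) = (\<lambda>x. 2 *\<^sub>R u n x - u (n - 1) x)"
        "ustar u (n + 1 + 1) = (\<lambda>x. 2 *\<^sub>R u (n + 1) x - u n x)"
      using n by (auto simp: ustar_def)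
    have star_L2: "ustar u (n + 1) \<in> L2_space \<Omega>"
      unfolding star by (intro L2_space_diff L2_space_scaleR L2 le)
    have "continuous_on (closure \<Omega>) (ustar u (n + 1))"
      unfolding star by (intro continuous_intros velocity_spaceD(1)[OF u] le)
    then obtain K where K: "\<And>x. x \<in> \<Omega> \<Longrightarrow> norm (ustar u (n + 1) x) \<le> K"
      using compact_closure_bound[OF \<Omega>(2)] by blast
    have W: "(\<lambda>x. vgrad \<Omega> (u (n + 1)) x *v ustar u (n + 1) x) \<in> L2_space \<Omega>"
      by (rule L2_space_matrix_vector_mult[where K = K, OF L2(2)[OF le(3)]])
        (use star_L2 K in \<open>auto simp: L2_space_def intro!: AE_I2\<close>)
    have p_in: "p (n + 1) \<in> Yh" and u_in: "u (n + 1) \<in> Xh"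
      using pressures velocities n le by auto
    \<comment> \<open>With the new velocity and the new pressure as test functions, the two
      divergence terms cancel by symmetry of the inner product.\<close>
    have tested: "l2_inner \<Omega> (\<lambda>x. (3 / (2 * \<tau>)) *\<^sub>R u (n + 1) x + vgrad \<Omega> (u (n + 1)) x *v ustar u (n + 1) x) (u (n + 1))
        + l2_inner \<Omega> (\<lambda>x. \<nu>s (n + 1) x *\<^sub>R vgrad \<Omega> (u (n + 1)) x) (vgrad \<Omega> (u (n + 1)))
        = l2_inner \<Omega> (\<lambda>x. (1 / (2 * \<tau>)) *\<^sub>R (4 *\<^sub>R u n x - u (n - 1) x)
          + 2 *\<^sub>R (transpose (vgrad \<Omega> (u n) x) *v wgrad \<Omega> (\<nu> n) x)
          - transpose (vgrad \<Omega> (u (n - 1)) x) *v wgrad \<Omega> (\<nu> (n - 1)) x) (u (n + 1))"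
      using scheme[OF n, unfolded imex_step_def, rule_format, OF u_in p_in]
        l2_inner_commute[of \<Omega> "p (n + 1)" "vdiv \<Omega> (u (n + 1))"]
      by linarith
    note balance = energy_balance[OF L2(2)[OF le(1)] L2(2)[OF le(2)] L2(2)[OF le(3)]
        L2(1)[OF le(2)] L2(1)[OF le(1)] L2(1)[OF le(3)] W
        grad(1)[OF le(1)] grad(1)[OF le(2)] grad(2)[OF le(1)] grad(2)[OF le(2)]
        visc[OF le(3)] bounds(1) \<tau> skew[OF n] tested]
    note forcing = forcing_bound[OF L2(2)[OF le(1)] L2(2)[OF le(2)] L2(1)[OF le(3)]
        grad(1)[OF le(1)] grad(1)[OF le(2)] grad(2)[OF le(1)] grad(2)[OF le(2)]
        visc[OF le(1)] visc[OF le(2)] bounds(1) eps(1) less_imp_le[OF \<tau>]]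
    show ?thesis
    proof (rule one_step_growth[OF s, where Z = Z and R = R and X = "B (n + 1)"])
      show "0 \<le> 4 * (1 - 10 * \<epsilon>) * \<tau> * D (n + 1)" "0 \<le> Z" "0 \<le> R"
        using eps \<tau> nonneg by (simp_all add: Z_def R_def)
      have "0 \<le> 8 * \<epsilon> * \<tau> * D m" for m
        using eps \<tau> nonneg by simp
      from this[of n] this[of "n - 1"] this[of "n + 1"]
      have BQ: "B n + Q n \<le> E n" "B (n + 1) + Q (n + 1) \<le> E (n + 1)" and R: "R \<le> E n - (B n + Q n)"
        unfolding R_def E_def add_diff_cancel_right' by linarith+
      show "R \<le> E n" "B (n + 1) \<le> E (n + 1)"
        using BQ R nonneg[of n] nonneg[of "n + 1"] by linarith+
      have "3 * B (n + 1) \<le> B (n + 1) + Q (n + 1) + Z + 2/3 * (B n + Q n)"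
        using bdf2_l2_identity(2)[OF L2(1)[OF le(2)] L2(1)[OF le(1)] L2(1)[OF le(3)]]
        unfolding B_def Q_def Z_def star .
      \<comment> \<open>Coercivity concerns the kinetic parts only; the viscous parts of the
        energies are nonnegative and may be added.\<close>
      also have "\<dots> \<le> E (n + 1) + Z + 2/3 * E n"
        using BQ by (intro add_mono mult_left_mono) auto
      finally show "3 * B (n + 1) \<le> E (n + 1) + Z + 2/3 * E n" .
      fix a b :: real
      assume ab: "0 \<le> a" "0 \<le> b" "a * b = s"
      then have "a * b * (\<epsilon> * \<nu>min) = \<tau> * G\<^sup>2"
        using eps bounds by (simp add: s_def)
      from forcing[OF ab(1,2) this] balance
      show "E (n + 1) + 4 * (1 - 10 * \<epsilon>) * \<tau> * D (n + 1) + Z \<le> E n - R + a * B (n + 1) + b * R"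
        unfolding R_def E_def Z_def B_def Q_def D_def star add_diff_cancel_right'
        by (simp add: algebra_simps)
    qed
  qed

  \<comment> \<open>Discrete Gronwall argument: level n is reached from level 1 in n - 1 steps, each
    costing a factor \<open>exp s\<close>. At n = 1 the sum is empty.\<close>
  have "E n + 4 * (1 - 10 * \<epsilon>) * \<tau> * (\<Sum>m = 2..n. D m) \<le> exp (real (n - 1) * s) * C" if "1 \<le> n" "n \<le> N" for n
    using that
  proof (induction n rule: dec_induct)
    case base
    then show ?case
      by (simp add: E_def C B_def Q_def D_def numeral_2_eq_2 algebra_simps)
  next
    case (step n)
    let ?c = "4 * (1 - 10 * \<epsilon>) * \<tau>"
    have sum_nonneg: "0 \<le> ?c * (\<Sum>m = 2..n. D m)"
      using eps \<tau> nonneg by (simp add: sum_nonneg)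
    have "E (Suc n) + ?c * (\<Sum>m = 2..Suc n. D m) = (E (n + 1) + ?c * D (n + 1)) + ?c * (\<Sum>m = 2..n. D m)"
      using step by (simp add: algebra_simps)
    \<comment> \<open>The dissipation accumulated so far is multiplied by \<open>exp s\<close> as
      well, harmless since this factor is at least 1; the induction hypothesis then applies to the
      whole.\<close>
    also have "\<dots> \<le> exp s * E n + exp s * (?c * (\<Sum>m = 2..n. D m))"
      using growth[of n] step sum_nonneg s mult_right_mono[of 1 "exp s" "?c * (\<Sum>m = 2..n. D m)"]
      by (intro add_mono) auto
    also have "\<dots> \<le> exp s * (exp (real (n - 1) * s) * C)"
      using step by (simp flip: distrib_left)
    also have "\<dots> = exp (real (Suc n - 1) * s) * C"
      using step by (simp add: of_nat_diff algebra_simps flip: exp_add)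
    finally show ?case .
  qed
  from this[of N] have "E N + 4 * (1 - 10 * \<epsilon>) * \<tau> * (\<Sum>m = 2..N. D m) \<le> exp (real (N - 1) * s) * C"
    using time by simp
  also have "\<dots> \<le> exp (G\<^sup>2 * T / (\<epsilon> * \<nu>min)) * C"
  proof (rule mult_right_mono)
    \<comment> \<open>One spare step is given away to reach the final time, since N \<tau> =
      T.\<close>
    have "real (N - 1) * s \<le> real N * s"
      using s by (intro mult_right_mono) auto
    also have "\<dots> = G\<^sup>2 * T / (\<epsilon> * \<nu>min)"
      using time by (simp add: s_def)
    finally show "exp (real (N - 1) * s) \<le> exp (G\<^sup>2 * T / (\<epsilon> * \<nu>min))" by simp
    show "0 \<le> C"
      unfolding C using \<tau> eps by simp
  qed
  finally show ?thesis
    by (simp add: E_def B_def Q_def D_def algebra_simps)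
qed

end
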